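(* Let $L$ be a link in $\mathbb R^3$. For every $i\in\mathbb Z$ the following two squares commute: $$\begin{array}{ccc}\mathcal H_e^i(L)&\xrightarrow{\ \varphi_{eo}\ }&\mathcal H_o^{i+1}(L)\\ \downarrow&&\downarrow\\ \mathcal H_{\mathbb Z_2}^i(L)&\xrightarrow{\ \beta_o\ }&\mathcal H_{\mathbb Z_2}^{i+1}(L)\end{array}\qquad\qquad\begin{array}{ccc}\mathcal H_o^i(L)&\xrightarrow{\ \varphi_{oe}\ }&\mathcal H_e^{i+1}(L)\\ \downarrow&&\downarrow\\ \mathcal H_{\mathbb Z_2}^i(L)&\xrightarrow{\ \beta_e\ }&\mathcal H_{\mathbb Z_2}^{i+1}(L)\end{array}$$ where the vertical maps are reduction modulo $2$, $\beta_e,\beta_o$ are the even and odd Bockstein homomorphisms, and $\varphi_{eo},\varphi_{oe}$ are the integral Bockstein homomorphisms defined by the unified Khovanov complex.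
   Context: Rings. $\mathbb Z_\xi=\mathbb Z[\xi]/(\xi^2-1)$, $\mathbb Z_e=\mathbb Z_\xi/(\xi-1)$, $\mathbb Z_o=\mathbb Z_\xi/(\xi+1)$; as groups $\mathbb Z_e\cong\mathbb Z_o\cong\mathbb Z$, with $\xi$ acting by $1$, respectively $-1$. $\mathbb Z_2=\mathbb Z/2$ has its unique $\mathbb Z_\xi$-module structure. Unified Khovanov complex. Let $D$ be a planar diagram of an oriented link $L$ with $n$ crossings, $n_+$ positive and $n_-$ negative. For $v\in\{0,1\}^n$ let $D_v$ be the collection of circles obtained by applying the usual Khovanov $0$- or $1$-smoothing at each crossing. Let $V(D_v)$ be the $\mathbb Z_\xi$-algebra generated by the circles of $D_v$ with relations $a^2=0$ and $ab=\xi ba$ for distinct circles $a,b$; after ordering the circles it is free over $\mathbb Z_\xi$ on ordered square-free monomials. At each crossing fix an orientation of the arc joining the two strands of the $0$-smoothing. For an edge $v\to w$ of the cube (changing one $0$ to $1$): if circles $a_1,a_2$ merge into $a$, the map $V(D_v)\to V(D_w)$ is the algebra map $a_1,a_2\mapsto a$, fixing the other circles; if a circle $a$ splits into $a_1,a_2$, where the arc rotated by $90^\circ$ counterclockwise points from $a_1$ to $a_2$, the map is $x\mapsto(a_1+\xi a_2)\tilde x$, where $\tilde x$ is $x$ with $a$ replaced by $a_1$ (or by $a_2$). Multiply each edge map by a unit in $\{\pm1,\pm\xi\}$ so that: after $\xi\mapsto 1$, every 2-face has an odd number of edges with unit $-1$; after $\xi\mapsto-1$, a 2-face has an odd number of such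 edges if the two composites of edge maps over $\mathbb Z_o$ are nonzero and commute, an even number if they are nonzero and anticommute, and if both composites vanish (one circle with one arc inside and one outside having interleaved endpoints) an odd or even number according to whether, going counterclockwise along the circle from the tail of the inner arc, the next endpoint is the tail or the head of the outer arc (the opposite convention gives an isomorphic complex). Such choices exist. Set $\mathcal C_\xi^i(D)=\bigoplus_{|v|=i+n_-}V(D_v)$ with differential $d_\xi$ the sum of the edge maps; a monomial of degree $k$ on $m$ circles at vertex $v$ has quantum grading $m-2k+|v|+n_+-2n_-$, preserved by $d_\xi$. Put $\mathcal C_e(D)=\mathcal C_\xi(D)\otimes_{\mathbb Z_\xi}\mathbb Z_e$, $\mathcal C_o(D)=\mathcal C_\xi(D)\otimes_{\mathbb Z_\xi}\mathbb Z_o$, $\mathcal C_{\mathbb Z_2}(D)=\mathcal C_\xi(D)\otimes_{\mathbb Z_\xi}\mathbb Z_2$ (even, odd, and mod 2 Khovanov complexes; $\mathcal C_{\mathbb Z_2}$ is the mod $2$ reduction of both $\mathcal C_e$ and $\mathcal C_o$), with differentials $d_e,d_o,d$ and cohomologies $\mathcal H_e(L),\mathcal H_o(L),\mathcal H_{\mathbb Z_2}(L)$; $\mathcal H_\xi(L)$ is the cohomology of $\mathcal C_\xi(D)$. Up to isomorphism these are invariants of $L$. Operations. $\beta_e,\beta_o:\mathcal H^i_{\mathbb Z_2}(L)\to\mathcal H^{i+1}_{\mathbb Z_2}(L)$ are the connecting homomorphisms of $0\to\mathbb Z_2\to\mathbb Z_4\to\mathbb Z_2\to0$ tensored over $\mathbb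 Z$ with $\mathcal C_e(D)$ and $\mathcal C_o(D)$ respectively, i.e. $\beta_e[x]=[\tfrac12 d_e x]$, $\beta_o[x]=[\tfrac12 d_o x]$ (computed on integral lifts of $x$). $\varphi_{eo}:\mathcal H_e^i(L)\to\mathcal H_o^{i+1}(L)$ is the connecting homomorphism of $0\to\mathcal C_o(D)\to\mathcal C_\xi(D)\to\mathcal C_e(D)\to0$ obtained by tensoring $\mathcal C_\xi(D)$ with $0\to\mathbb Z_o\xrightarrow{1\mapsto1-\xi}\mathbb Z_\xi\to\mathbb Z_e\to0$; $\varphi_{oe}:\mathcal H_o^i(L)\to\mathcal H_e^{i+1}(L)$ is the connecting homomorphism of $0\to\mathcal C_e(D)\to\mathcal C_\xi(D)\to\mathcal C_o(D)\to0$ obtained from $0\to\mathbb Z_e\xrightarrow{1\mapsto1+\xi}\mathbb Z_\xi\to\mathbb Z_o\to0$. *)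

theory Defs
  imports
    "HOL-Algebra.Coset"
    "HOL-Computational_Algebra.Polynomial"
    "HOL-Library.Numeral_Type"
    "HOL-Library.Z2"
begin

section \<open>Coefficient rings\<close>

quotient_type zxi = "int poly" / "\<lambda>p q. [:-1, 0, 1:] dvd p - q"
proof (rule equivpI)
  show "reflp (\<lambda>p q :: int poly. [:-1, 0, 1:] dvd p - q)"
    by (simp add: reflp_def)
  show "symp (\<lambda>p q :: int poly. [:-1, 0, 1:] dvd p - q)"
    by (metis (mono_tags, lifting) dvd_minus_iff minus_diff_eq sympI)
  show "transp (\<lambda>p q :: int poly. [:-1, 0, 1:] dvd p - q)"
  proof (rule transpI)
    fix p q r :: "int poly"
    assume "[:-1, 0, 1:] dvd p - q" "[:-1, 0, 1:] dvd q - r"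
    from dvd_add[OF this] show "[:-1, 0, 1:] dvd p - r" by simp
  qed
qed

instantiation zxi :: comm_ring_1
begin

lift_definition zero_zxi :: zxi is 0 .
lift_definition one_zxi :: zxi is 1 .
lift_definition plus_zxi :: "zxi \<Rightarrow> zxi \<Rightarrow> zxi" is "(+)"
proof -
  fix p p' q q' :: "int poly"
  assume "[:-1, 0, 1:] dvd p - p'" "[:-1, 0, 1:] dvd q - q'"
  then have "[:-1, 0, 1:] dvd (p - p') + (q - q')" by (rule dvd_add)
  then show "[:-1, 0, 1:] dvd (p + q) - (p' + q')" by (simp add: algebra_simps)
qed
lift_definition uminus_zxi :: "zxi \<Rightarrow> zxi" is uminus
  by (metis dvd_minus_iff minus_diff_minus)
lift_definition minus_zxi :: "zxi \<Rightarrow> zxi \<Rightarrow> zxi" is "(-)"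
proof -
  fix p p' q q' :: "int poly"
  assume "[:-1, 0, 1:] dvd p - p'" "[:-1, 0, 1:] dvd q - q'"
  then have "[:-1, 0, 1:] dvd (p - p') - (q - q')" by (rule dvd_diff)
  then show "[:-1, 0, 1:] dvd (p - q) - (p' - q')" by (simp add: algebra_simps)
qed
lift_definition times_zxi :: "zxi \<Rightarrow> zxi \<Rightarrow> zxi" is "(*)"
proof -
  fix p p' q q' :: "int poly"
  assume "[:-1, 0, 1:] dvd p - p'" "[:-1, 0, 1:] dvd q - q'"
  then have "[:-1, 0, 1:] dvd (p - p') * q + p' * (q - q')"
    by (intro dvd_add dvd_mult dvd_mult2)
  then show "[:-1, 0, 1:] dvd p * q - p' * q'" by (simp add: algebra_simps)
qed

instance
proof
  have "\<not> [:-1, 0, 1:] dvd (- 1 :: int poly)"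
    by (auto dest: dvd_imp_degree_le)
  then show "(0::zxi) \<noteq> 1" by transfer simp
qed (transfer; simp add: algebra_simps)+

end

lift_definition xi :: zxi is "[:0, 1:]" .

text \<open>The projections of \<open>\<int>[\<xi>]/(\<xi>\<^sup>2 - 1)\<close> onto \<open>\<int>\<^sub>e\<close>, \<open>\<int>\<^sub>o\<close> and \<open>\<int>\<^sub>2\<close>. The quotients by
  \<open>\<xi> - 1\<close> and by \<open>\<xi> + 1\<close> are both identified with \<open>\<int>\<close> by evaluation at \<open>\<xi> = 1\<close> and at \<open>\<xi> = -1\<close>.\<close>

lift_definition to_e :: "zxi \<Rightarrow> int" is "\<lambda>p. poly p 1"
proof -
  fix p q :: "int poly" assume "[:-1, 0, 1:] dvd p - q"
  then obtain r where "p - q = [:-1, 0, 1:] * r" ..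
  then have "poly (p - q) 1 = 0" by simp
  then show "poly p 1 = poly q 1" by simp
qed

lift_definition to_o :: "zxi \<Rightarrow> int" is "\<lambda>p. poly p (- 1)"
proof -
  fix p q :: "int poly" assume "[:-1, 0, 1:] dvd p - q"
  then obtain r where "p - q = [:-1, 0, 1:] * r" ..
  then have "poly (p - q) (- 1) = 0" by simp
  then show "poly p (- 1) = poly q (- 1)" by simp
qed

definition to_2 :: "zxi \<Rightarrow> bit"
  where "to_2 z = of_int (to_e z)"

definition from_o :: "int \<Rightarrow> zxi"
  where "from_o m = of_int m * (1 - xi)"

definition from_e :: "int \<Rightarrow> zxi"
  where "from_e m = of_int m * (1 + xi)"

definition bit_to_Z4 :: "bit \<Rightarrow> 4"
  where "bit_to_Z4 b = (if b = 0 then 0 else 2)"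

definition Z4_to_bit :: "4 \<Rightarrow> bit"
  where "Z4_to_bit m = (if m = 0 \<or> m = 2 then 0 else 1)"


section \<open>Oriented planar link diagrams\<close>

text \<open>
  A diagram is an oriented planar diagram code. The crossings are \<open>0, \<dots>, ncross - 1\<close>; the four
  strand ends (\<^emph>\<open>darts\<close>) at crossing \<open>c\<close> are \<open>(c, 0), \<dots>, (c, 3)\<close>, listed counterclockwise from
  the incoming end of the lower strand. So the lower strand runs from \<open>(c, 0)\<close> to \<open>(c, 2)\<close>, and the
  upper strand from \<open>(c, 3)\<close> to \<open>(c, 1)\<close> at a positive crossing and from \<open>(c, 1)\<close> to \<open>(c, 3)\<close> at a
  negative one. Each edge between crossings has a label, which is carried by both of its ends.
  The elements of \<open>loops\<close> are the labels of the components without crossings.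
\<close>

type_synonym dart = "nat \<times> nat"

record diagram =
  ncross :: nat
  label :: "dart \<Rightarrow> nat"
  pos :: "nat \<Rightarrow> bool"
  loops :: "nat set"

definition darts :: "diagram \<Rightarrow> dart set"
  where "darts D = {..<ncross D} \<times> {..<4}"

definition incoming :: "diagram \<Rightarrow> dart set"
  where "incoming D =
    {(c, k). c < ncross D \<and> (k = 0 \<or> k = (if pos D c then 3 else 1))}"

definition outgoing :: "diagram \<Rightarrow> dart set"
  where "outgoing D =
    {(c, k). c < ncross D \<and> (k = 2 \<or> k = (if pos D c then 1 else 3))}"

definition edges :: "diagram \<Rightarrow> nat set"
  where "edges D = label D ` darts D \<union> loops D"

definition n_minus :: "diagram \<Rightarrow> nat"
  where "n_minus D = card {c. c < ncross D \<and> \<not> pos D c}"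

definition other_end :: "diagram \<Rightarrow> dart \<Rightarrow> dart"
  where "other_end D p = (THE q. q \<in> darts D \<and> q \<noteq> p \<and> label D q = label D p)"

definition components :: "'a set \<Rightarrow> ('a \<times> 'a) set \<Rightarrow> 'a set set"
  where "components A r = A // {(x, y). x \<in> A \<and> y \<in> A \<and> (x, y) \<in> (r \<union> r\<inverse>)\<^sup>*}"

definition rot :: "dart \<Rightarrow> dart"
  where "rot p = (fst p, (snd p + 1) mod 4)"

definition faces :: "diagram \<Rightarrow> dart set set"
  where "faces D = components (darts D) {(p, rot (other_end D p)) | p. p \<in> darts D}"

definition graph_components :: "diagram \<Rightarrow> nat set set"
  where "graph_components D =
    components {..<ncross D} {(fst p, fst (other_end D p)) | p. p \<in> darts D}"

text \<open>
  The last condition is planarity: Euler's formula \<open>V - E + F = 2 K\<close> for the surface built from the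
  four-valent graph (without the loops) and its cyclic orders at the crossings, \<open>K\<close> being the number of
  connected components of the graph. How the connected components are placed relative to each other in
  the plane plays no role for the Khovanov complexes and is not recorded.
\<close>

definition planar_diagram :: "diagram \<Rightarrow> bool"
  where "planar_diagram D \<longleftrightarrow>
    inj_on (label D) (incoming D) \<and> inj_on (label D) (outgoing D) \<and>
    label D ` incoming D = label D ` outgoing D \<and>
    finite (loops D) \<and> loops D \<inter> label D ` darts D = {} \<and>
    ncross D + card (faces D) = card (label D ` darts D) + 2 * card (graph_components D)"


section \<open>Smoothings\<close>

text \<open>
  A vertex of the cube is the set \<open>v \<subseteq> {..<ncross D}\<close> of the crossings that receive the
  1-smoothing. The 0-smoothing (the orientation-preserving one at a positive crossing) connects dart 0
  to 1 and 2 to 3, the 1-smoothing connects 1 to 2 and 3 to 0.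
\<close>

definition smooth :: "nat set \<Rightarrow> dart \<Rightarrow> dart"
  where "smooth v p = (let (c, k) = p in
    (c, if c \<in> v then 3 - k else if even k then k + 1 else k - 1))"

definition smoothing_rel :: "diagram \<Rightarrow> nat set \<Rightarrow> (nat \<times> nat) set"
  where "smoothing_rel D v = {(label D p, label D (smooth v p)) | p. p \<in> darts D}"

text \<open>The circle through an edge \<open>e\<close>; a circle is named by the least label of the edges on it. In
  particular, circles are linearly ordered, and a circle not touched by a change of smoothing keeps
  its name.\<close>

definition circle :: "diagram \<Rightarrow> nat set \<Rightarrow> nat \<Rightarrow> nat"
  where "circle D v e = Min ((smoothing_rel D v)\<^sup>* `` {e})"

definition circles :: "diagram \<Rightarrow> nat set \<Rightarrow> nat set"
  where "circles D v = circle D v ` edges D"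


section \<open>The algebras \<open>V(D\<^sub>v)\<close> and the edge maps\<close>

text \<open>
  Elements are given by their coefficients on the ordered square-free monomials, a monomial being
  the finite set of its factors. In the product of the monomials \<open>S\<close> and \<open>T\<close>, every pair \<open>s \<in> S\<close>, \<open>t \<in> T\<close>
  with \<open>t < s\<close> has to be interchanged and contributes a factor \<open>\<xi>\<close>.
\<close>

type_synonym valg = "nat set \<Rightarrow> zxi"

definition monomial :: "nat set \<Rightarrow> valg"
  where "monomial S = (\<lambda>T. if T = S then 1 else 0)"

definition vmult :: "valg \<Rightarrow> valg \<Rightarrow> valg"
  where "vmult x y = (\<lambda>U. \<Sum>S\<in>Pow U.
    xi ^ card {(s, t). s \<in> S \<and> t \<in> U - S \<and> t < s} * x S * y (U - S))"

definition word :: "nat list \<Rightarrow> valg"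
  where "word as = foldr (\<lambda>a. vmult (monomial {a})) as (monomial {})"

text \<open>The image of the monomial \<open>S\<close> under the algebra map given on generators by \<open>f\<close>.\<close>

definition alg_map :: "(nat \<Rightarrow> nat) \<Rightarrow> nat set \<Rightarrow> valg"
  where "alg_map f S = word (map f (sorted_list_of_set S))"

text \<open>
  \<open>arc c\<close> says how the arc at \<open>c\<close> is oriented in the 0-smoothing: from the strand 01 to the strand 23 if
  \<open>arc c\<close> holds, and from 23 to 01 otherwise. In the first case the arc rotated counterclockwise
  by 90 degrees points from the strand 12 of the 1-smoothing to the strand 30.

  \<open>edge_map D arc v c S\<close> is the image of the monomial \<open>S\<close> on \<open>circles D v\<close> under the map (without
  unit) belonging to the edge from \<open>v\<close> to \<open>insert c v\<close>.
\<close>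

definition edge_map :: "diagram \<Rightarrow> (nat \<Rightarrow> bool) \<Rightarrow> nat set \<Rightarrow> nat \<Rightarrow> nat set \<Rightarrow> valg"
  where "edge_map D arc v c S =
    (let w = insert c v;
         a1 = circle D v (label D (c, 0));
         a2 = circle D v (label D (c, 2))
     in if a1 \<noteq> a2
        then alg_map (\<lambda>b. if b = a1 \<or> b = a2 then circle D w (label D (c, 0)) else b) S
        else let b1 = circle D w (label D (c, if arc c then 1 else 3));
                 b2 = circle D w (label D (c, if arc c then 3 else 1))
             in vmult (\<lambda>T. monomial {b1} T + xi * monomial {b2} T)
                      (alg_map (\<lambda>b. if b = a1 then b1 else b) S))"


section \<open>Choice of units\<close>

definition face_edges :: "nat set \<Rightarrow> nat \<Rightarrow> nat \<Rightarrow> (nat set \<times> nat) set"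
  where "face_edges v c c' = {(v, c), (insert c v, c'), (v, c'), (insert c' v, c)}"

text \<open>Matrix of the composite over \<open>\<int>\<^sub>o\<close> along \<open>v \<rightarrow> insert c v \<rightarrow> insert c' (insert c v)\<close>.\<close>

definition odd_composite ::
    "diagram \<Rightarrow> (nat \<Rightarrow> bool) \<Rightarrow> nat set \<Rightarrow> nat \<Rightarrow> nat \<Rightarrow> nat set \<Rightarrow> nat set \<Rightarrow> int"
  where "odd_composite D arc v c c' S U =
    (if S \<subseteq> circles D v
     then \<Sum>T\<in>Pow (circles D (insert c v)).
            to_o (edge_map D arc v c S T) * to_o (edge_map D arc (insert c v) c' T U)
     else 0)"

text \<open>
  Walking along the circles of \<open>D\<^sub>v\<close>: \<open>walk D v\<close> sends the dart through which a crossing is left to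
  the dart through which the next crossing on the circle is left.
\<close>

definition walk :: "diagram \<Rightarrow> nat set \<Rightarrow> dart \<Rightarrow> dart"
  where "walk D v p = smooth v (other_end D p)"

definition next_endpoint :: "diagram \<Rightarrow> nat set \<Rightarrow> nat \<Rightarrow> nat \<Rightarrow> dart \<Rightarrow> dart"
  where "next_endpoint D v c c' p =
    (walk D v ^^ (LEAST m. 0 < m \<and> fst ((walk D v ^^ m) p) \<in> {c, c'})) p"

text \<open>
  Used only if \<open>c\<close> and \<open>c'\<close> are 0-smoothed at \<open>v\<close> and their arcs have interleaved endpoints on opposite
  sides of one circle. The arc at \<open>c\<close> is to the left of the walk exactly if
  the crossing is left through dart 1 or 3; these belong to the strands 01 and 23 respectively.
  Going counterclockwise along the circle means having the inner arc on the left. Hence, if the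
  arc at \<open>c\<close> is the inner one, this says that going counterclockwise from its tail the next
  endpoint is the tail of the outer arc. Exchanging the roles of the two arcs reverses the direction
  of the walk and starts at the tail of the other arc, so the condition is symmetric in \<open>c\<close> and \<open>c'\<close>,
  and it does not matter which of the two arcs is the inner one.
\<close>

definition next_is_tail :: "diagram \<Rightarrow> (nat \<Rightarrow> bool) \<Rightarrow> nat set \<Rightarrow> nat \<Rightarrow> nat \<Rightarrow> bool"
  where "next_is_tail D arc v c c' \<longleftrightarrow>
    (let q = next_endpoint D v c c' (c, if arc c then 1 else 3)
     in fst q = c' \<and> (snd q \<in> {0, 1} \<longleftrightarrow> arc c'))"

definition unit_choice ::
    "diagram \<Rightarrow> (nat \<Rightarrow> bool) \<Rightarrow> (nat set \<times> nat \<Rightarrow> zxi) \<Rightarrow> bool"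
  where "unit_choice D arc u \<longleftrightarrow>
    (\<forall>v c. v \<subseteq> {..<ncross D} \<and> c < ncross D \<and> c \<notin> v \<longrightarrow> u (v, c) \<in> {1, -1, xi, -xi}) \<and>
    (\<forall>v c c'. v \<subseteq> {..<ncross D} \<and> c < ncross D \<and> c' < ncross D \<and> c \<notin> v \<and> c' \<notin> v \<and> c \<noteq> c' \<longrightarrow>
      (let n_e = card {e \<in> face_edges v c c'. to_e (u e) = -1};
           n_o = card {e \<in> face_edges v c c'. to_o (u e) = -1};
           f = odd_composite D arc v c c';
           g = odd_composite D arc v c' c
       in odd n_e \<and>
          (f \<noteq> (\<lambda>S U. 0) \<and> g \<noteq> (\<lambda>S U. 0) \<and> f = g \<longrightarrow> odd n_o) \<and>
          (f \<noteq> (\<lambda>S U. 0) \<and> g \<noteq> (\<lambda>S U. 0) \<and> f = (\<lambda>S U. - g S U) \<longrightarrow> even n_o) \<and>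
          (f = (\<lambda>S U. 0) \<and> g = (\<lambda>S U. 0) \<longrightarrow> (odd n_o \<longleftrightarrow> next_is_tail D arc v c c'))))"


section \<open>The complexes\<close>

type_synonym gen = "nat set \<times> nat set"

text \<open>Generators in homological degree \<open>i\<close>: a vertex \<open>v\<close> with a monomial on the circles of \<open>D\<^sub>v\<close>.\<close>

definition gens :: "diagram \<Rightarrow> int \<Rightarrow> gen set"
  where "gens D i = {(v, S). v \<subseteq> {..<ncross D} \<and> int (card v) = i + int (n_minus D) \<and>
    S \<subseteq> circles D v}"

text \<open>\<open>\<C>\<^sub>\<xi>\<^sup>i(D)\<close> is free on \<open>gens D i\<close>, so its base change to a ring \<open>'r\<close> consists of the following
  coefficient functions, and the differential of the base change along \<open>h\<close> is obtained by applying
  \<open>h\<close> to the matrix of \<open>d\<^sub>\<xi>\<close>.\<close>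

definition cochains :: "diagram \<Rightarrow> int \<Rightarrow> (gen \<Rightarrow> 'r::comm_ring_1) set"
  where "cochains D i = {x. \<forall>g. g \<notin> gens D i \<longrightarrow> x g = 0}"

definition d_matrix ::
    "diagram \<Rightarrow> (nat \<Rightarrow> bool) \<Rightarrow> (nat set \<times> nat \<Rightarrow> zxi) \<Rightarrow> gen \<Rightarrow> gen \<Rightarrow> zxi"
  where "d_matrix D arc u g g' = (let (v, S) = g; (w, T) = g' in
    \<Sum>c\<in>{..<ncross D} - v. if w = insert c v then u (v, c) * edge_map D arc v c S T else 0)"

definition differential ::
    "(zxi \<Rightarrow> 'r::comm_ring_1) \<Rightarrow> diagram \<Rightarrow> (nat \<Rightarrow> bool) \<Rightarrow> (nat set \<times> nat \<Rightarrow> zxi) \<Rightarrow>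
      (gen \<Rightarrow> 'r) \<Rightarrow> gen \<Rightarrow> 'r"
  where "differential h D arc u x = (\<lambda>g'.
    \<Sum>v\<in>Pow {..<ncross D}. \<Sum>S\<in>Pow (circles D v). h (d_matrix D arc u (v, S) g') * x (v, S))"

abbreviation "d_xi \<equiv> differential id"
abbreviation "d_e \<equiv> differential to_e"
abbreviation "d_o \<equiv> differential to_o"
abbreviation "d_2 \<equiv> differential to_2"

text \<open>The differentials of \<open>\<C>\<^sub>e(D) \<otimes> \<int>\<^sub>4\<close> and \<open>\<C>\<^sub>o(D) \<otimes> \<int>\<^sub>4\<close>.\<close>

abbreviation "d_e4 \<equiv> differential (\<lambda>z. of_int (to_e z) :: 4)"
abbreviation "d_o4 \<equiv> differential (\<lambda>z. of_int (to_o z) :: 4)"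


section \<open>Cohomology\<close>

definition cocycle_group ::
    "diagram \<Rightarrow> ((gen \<Rightarrow> 'r::comm_ring_1) \<Rightarrow> gen \<Rightarrow> 'r) \<Rightarrow> int \<Rightarrow> (gen \<Rightarrow> 'r) monoid"
  where "cocycle_group D d i =
    \<lparr>carrier = {x \<in> cochains D i. d x = (\<lambda>g. 0)}, monoid.mult = (\<lambda>x y g. x g + y g), one = (\<lambda>g. 0)\<rparr>"

definition cohomology ::
    "diagram \<Rightarrow> ((gen \<Rightarrow> 'r::comm_ring_1) \<Rightarrow> gen \<Rightarrow> 'r) \<Rightarrow> int \<Rightarrow> (gen \<Rightarrow> 'r) set monoid"
  where "cohomology D d i = cocycle_group D d i Mod (d ` cochains D (i - 1))"

text \<open>The map \<open>H\<^sup>i \<rightarrow> H\<^sup>i\<close> induced by the coefficient map \<open>f\<close>; \<open>d'\<close> is the differential of the target.\<close>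

definition induced ::
    "diagram \<Rightarrow> ('r \<Rightarrow> 's) \<Rightarrow> ((gen \<Rightarrow> 's::comm_ring_1) \<Rightarrow> gen \<Rightarrow> 's) \<Rightarrow> int \<Rightarrow>
      (gen \<Rightarrow> 'r) set \<Rightarrow> (gen \<Rightarrow> 's) set"
  where "induced D f d' i a =
    (THE b. b \<in> carrier (cohomology D d' i) \<and> (\<exists>x\<in>a. f \<circ> x \<in> b))"

text \<open>The connecting homomorphism \<open>H\<^sup>i(C'') \<rightarrow> H\<^sup>i\<^sup>+\<^sup>1(C')\<close> of a sequence \<open>0 \<rightarrow> C' \<rightarrow> C \<rightarrow> C'' \<rightarrow> 0\<close> whose
  maps are given by the coefficient maps \<open>f\<close> and \<open>p\<close>; \<open>d'\<close> and \<open>d\<close> are the differentials of \<open>C'\<close> and \<open>C\<close>.\<close>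

definition connecting ::
    "diagram \<Rightarrow> ('r \<Rightarrow> 's) \<Rightarrow> ('s \<Rightarrow> 't) \<Rightarrow> ((gen \<Rightarrow> 'r::comm_ring_1) \<Rightarrow> gen \<Rightarrow> 'r) \<Rightarrow>
      ((gen \<Rightarrow> 's::comm_ring_1) \<Rightarrow> gen \<Rightarrow> 's) \<Rightarrow> int \<Rightarrow> (gen \<Rightarrow> 't) set \<Rightarrow> (gen \<Rightarrow> 'r) set"
  where "connecting D f p d' d i a =
    (THE b. b \<in> carrier (cohomology D d' (i + 1)) \<and>
      (\<exists>x\<in>cochains D i. \<exists>y\<in>b. p \<circ> x \<in> a \<and> d x = f \<circ> y))"

definition "H_e D arc u i = cohomology D (d_e D arc u) i"
definition "H_o D arc u i = cohomology D (d_o D arc u) i"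

text \<open>Reduction modulo 2, both from \<open>H_e\<close> and from \<open>H_o\<close> to the cohomology of \<open>\<C>(D) \<otimes> \<int>\<^sub>2\<close>:
  \<open>to_e\<close> and \<open>to_o\<close> agree modulo 2, so \<open>d_2\<close> is the reduction of both \<open>d_e\<close> and \<open>d_o\<close>.\<close>

definition "red_2 D arc u i = induced D (of_int :: int \<Rightarrow> bit) (d_2 D arc u) i"

definition "phi_eo D arc u i = connecting D from_o to_e (d_o D arc u) (d_xi D arc u) i"
definition "phi_oe D arc u i = connecting D from_e to_o (d_e D arc u) (d_xi D arc u) i"

definition "beta_e D arc u i =
  connecting D bit_to_Z4 Z4_to_bit (d_2 D arc u) (d_e4 D arc u) i"
definition "beta_o D arc u i =
  connecting D bit_to_Z4 Z4_to_bit (d_2 D arc u) (d_o4 D arc u) i"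

end

theory Submission
  imports Defs
begin

text \<open>
  The idea. Represent a class of the even cohomology by an integral cochain \<open>x\<close>, and regard its
  coefficients as elements of \<open>\<int>\<^sub>\<xi>\<close>. As \<open>x\<close> is an even cocycle, \<open>d\<^sub>\<xi> x = (1 - \<xi>) y\<close>, and \<open>y\<close>
  represents the integral Bockstein. Setting \<open>\<xi> = -1\<close> turns this into \<open>d\<^sub>o x = 2 y\<close>, which says that
  \<open>y\<close> modulo 2 represents the odd Bockstein of \<open>x\<close> modulo 2. The second square is the same with the
  signs of \<open>\<xi>\<close> exchanged. This is \<open>bockstein_square\<close>.

  The classes in this argument are well defined (\<open>induced_cohomology_class\<close> and
  \<open>connecting_cohomology_class\<close>) because the \<open>\<C>\<^sub>\<xi>(D)\<close> of the definition is a complex, and most of the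
  proof is devoted to \<open>d\<^sub>\<xi>\<^sup>2 = 0\<close> (\<open>d_matrix_square\<close>), that is, to the 2-faces of the cube.

  For these it is convenient to write a monomial as a word of edge labels, each label standing for the
  circle through it. A merge leaves such a word as it is, and a split multiplies it by a factor
  \<open>p + \<xi> q\<close> (\<open>edge_map_merge\<close>, \<open>edge_map_split\<close>). A short case distinction then shows that the two
  composites along a 2-face agree up to a factor \<open>1\<close> or \<open>\<xi>\<close> (\<open>face_words\<close>), so that over \<open>\<int>\<^sub>e\<close> they are
  equal and over \<open>\<int>\<^sub>o\<close> they are equal or opposite. The sign conditions on the units make the two
  paths cancel in either case (\<open>face_cancels\<close>), and an element of \<open>\<int>\<^sub>\<xi>\<close> is determined by its images in
  \<open>\<int>\<^sub>e\<close> and \<open>\<int>\<^sub>o\<close>.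

  The description of the edge maps presupposes that changing one smoothing always merges two circles or
  splits one. This is where planarity is used: Euler's formula yields a checkerboard colouring
  (\<open>checkerboard_colouring\<close>), which orients the circles of all smoothings coherently. Circles are then
  the cycles of a permutation, a change of smoothing multiplies it by a transposition, and a
  transposition merges two cycles or splits one (\<open>smoothings_differ\<close>).
\<close>

section \<open>The coefficient ring\<close>

lemma xi_square: "xi * xi = 1"
proof (transfer)
  have "[:0, 1:] * [:0, 1:] - 1 = [:-1, 0, 1::int:]" by (simp add: one_pCons)
  then show "[:-1, 0, 1:] dvd [:0, 1:] * [:0, 1:] - (1 :: int poly)" by simp
qed

lemma xi_square_left: "xi * (xi * z) = z"
  by (simp add: xi_square flip: mult.assoc)

lemma to_e_hom: "to_e 0 = 0" "to_e 1 = 1" "to_e (x + y) = to_e x + to_e y" "to_e (x * y) = to_e x * to_e y"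
   "to_e (- x) = - to_e x" "to_e (x - y) = to_e x - to_e y" "to_e xi = 1"
  by (transfer; simp)+

lemma to_o_hom: "to_o 0 = 0" "to_o 1 = 1" "to_o (x + y) = to_o x + to_o y" "to_o (x * y) = to_o x * to_o y"
   "to_o (- x) = - to_o x" "to_o (x - y) = to_o x - to_o y" "to_o xi = -1"
  by (transfer; simp)+

lemma to_e_of_int: "to_e (of_int m) = m"
  by (induction m rule: int_induct[of _ 0]) (simp_all add: to_e_hom)

lemma to_o_of_int: "to_o (of_int m) = m"
  by (induction m rule: int_induct[of _ 0]) (simp_all add: to_o_hom)

lemmas [transfer_rule] = transfer_rule_of_int[OF zero_zxi.transfer one_zxi.transfer plus_zxi.transfer uminus_zxi.transfer]

text \<open>
  Dividing first by \<open>\<xi> - 1\<close> and the quotient by \<open>\<xi> + 1\<close> leaves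
  a multiple of \<open>\<xi>\<^sup>2 - 1\<close>. In this basis the evaluation at
  \<open>\<xi> = 1\<close> reads off \<open>a\<close>, and the one at \<open>\<xi> = -1\<close>
  gives \<open>a - 2 b\<close>.
\<close>

lemma zxi_normal_form: "\<exists>a b. z = of_int a + of_int b * (xi - 1)"
proof (transfer)
  fix p :: "int poly"
  have "[:-1, 1:] dvd p - [:poly p 1:]"
    using poly_eq_0_iff_dvd[of "p - [:poly p 1:]" 1] by simp
  then obtain q where q: "p - [:poly p 1:] = [:-1, 1:] * q" ..
  have "[:1, 1:] dvd q - [:poly q (-1):]"
    using poly_eq_0_iff_dvd[of "q - [:poly q (-1):]" "-1"] by simp
  then obtain r where r: "q - [:poly q (-1):] = [:1, 1:] * r" ..
  have m: "[:0, 1:] - 1 = [:-1, 1::int:]" by (simp add: one_pCons)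
  have "p - (of_int (poly p 1) + of_int (poly q (-1)) * ([:0, 1:] - 1)) =
      (p - [:poly p 1:]) - [:poly q (-1):] * [:-1, 1:]"
    unfolding m of_int_poly by (simp only: of_int_eq_id id_apply diff_diff_eq)
  also have "\<dots> = [:-1, 1:] * (q - [:poly q (-1):])"
    unfolding q by (simp only: right_diff_distrib mult.commute)
  also have "\<dots> = ([:-1, 1:] * [:1, 1:]) * r" using r by (simp only: mult.assoc)
  also have "[:-1, 1:] * [:1, 1:] = [:-1, 0, 1::int:]" by simp
  finally show "\<exists>a b. [:-1, 0, 1:] dvd p - (of_int a + of_int b * ([:0, 1:] - 1))"
    by (metis dvd_triv_left)
qed

text \<open>
  The ring embeds into the product of its even and odd quotients. Identities over it can
  therefore be checked separately in the even and in the odd theory.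
\<close>

lemma zxi_eqI: assumes "to_e z = to_e z'" "to_o z = to_o z'" shows "z = z'"
proof -
  obtain a b where ab: "z - z' = of_int a + of_int b * (xi - 1)" using zxi_normal_form by blast
  have "to_e (z - z') = 0" "to_o (z - z') = 0" using assms by (simp_all add: to_e_hom to_o_hom)
  then have "a = 0" "a - 2 * b = 0"
    unfolding ab by (simp_all add: to_e_hom to_o_hom to_e_of_int to_o_of_int)
  then show ?thesis using ab by simp
qed

section \<open>Products of circles and the split element\<close>

text \<open>
  Multiplication from the left by a single circle; the exponent counts the factors of the
  monomial that the new one has to pass to reach its place.
\<close>

definition left_mult :: "nat \<Rightarrow> valg \<Rightarrow> valg"
  where "left_mult a y = (\<lambda>U. if a \<in> U then xi ^ card {t \<in> U. t < a} * y (U - {a}) else 0)"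

text \<open>
  On infinite sets \<open>vmult\<close> is a sum over an infinite power set and so vanishes,
  whence the condition on \<open>y\<close>.
\<close>

lemma vmult_monomial:
  assumes "\<And>U. infinite U \<Longrightarrow> y U = 0"
  shows "vmult (monomial {a}) y = left_mult a y"
proof
  fix U
  have card: "card {(s, t). s \<in> {a} \<and> t \<in> U - {a} \<and> t < s} = card {t \<in> U. t < a}"
  proof -
    have "{(s, t). s \<in> {a} \<and> t \<in> U - {a} \<and> t < s} = Pair a ` {t \<in> U. t < a}" by auto
    then show ?thesis by (simp add: card_image inj_on_def)
  qed
  consider "infinite U" | "finite U" "a \<in> U" | "finite U" "a \<notin> U" by blast
  then show "vmult (monomial {a}) y U = left_mult a y U"
  proof cases
    case 1
    then show ?thesis by (simp add: vmult_def left_mult_def assms)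
  next
    case 2
    have "vmult (monomial {a}) y U = (\<Sum>S\<in>{{a}}. xi ^ card {(s, t). s \<in> S \<and> t \<in> U - S \<and> t < s}
        * monomial {a} S * y (U - S))"
      unfolding vmult_def using 2 by (intro sum.mono_neutral_right) (auto simp: monomial_def)
    then show ?thesis using 2 card by (simp add: left_mult_def monomial_def)
  next
    case 3
    then have "vmult (monomial {a}) y U = 0"
      unfolding vmult_def by (intro sum.neutral) (auto simp: monomial_def)
    then show ?thesis using 3 by (simp add: left_mult_def)
  qed
qed

lemma left_mult_scale: "left_mult a (\<lambda>U. c * x U) = (\<lambda>U. c * left_mult a x U)"
  by (auto simp: left_mult_def fun_eq_iff)

lemma left_mult_add: "left_mult a (\<lambda>U. x U + y U) = (\<lambda>U. left_mult a x U + left_mult a y U)"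
  by (auto simp: left_mult_def fun_eq_iff algebra_simps)

lemma left_mult_zero: "left_mult a (\<lambda>U. 0) = (\<lambda>U. 0)"
  by (auto simp: left_mult_def fun_eq_iff)

lemma left_mult_left_mult_self: "left_mult a (left_mult a y) = (\<lambda>U. 0)"
  by (auto simp: left_mult_def fun_eq_iff)

lemma left_mult_commute: "left_mult a (left_mult b y) = (\<lambda>U. xi * left_mult b (left_mult a y) U)"
proof -
  have less: "left_mult a (left_mult b y) U = xi * left_mult b (left_mult a y) U" if "a < b" for a b U
  proof (cases "a \<in> U \<and> b \<in> U")
    case True
    have "{t \<in> U. t < b} = insert a {t \<in> U. t \<noteq> a \<and> t < b}" using True that by auto
    then have 1: "card {t \<in> U. t < b} = Suc (card {t \<in> U. t \<noteq> a \<and> t < b})" by simp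
    have 2: "{t \<in> U. t \<noteq> b \<and> t < a} = {t \<in> U. t < a}" using that by auto
    have 3: "U - {a} - {b} = U - {b} - {a}" by auto
    show ?thesis using True that
      by (simp add: left_mult_def 1 2 3 xi_square_left mult.left_commute mult.assoc)
  qed (use that in \<open>auto simp: left_mult_def\<close>)
  show ?thesis
  proof
    fix U
    consider "a < b" | "a = b" | "b < a" by linarith
    then show "left_mult a (left_mult b y) U = xi * left_mult b (left_mult a y) U"
    proof cases
      case 1 then show ?thesis by (rule less)
    next
      case 2 then show ?thesis by (simp add: left_mult_left_mult_self)
    next
      case 3 then show ?thesis by (simp add: less[OF 3] xi_square_left)
    qed
  qed
qed

lemma word_infinite: "infinite U \<Longrightarrow> word as U = 0"
proof (induction as arbitrary: U)
  case Nil
  then show ?case by (auto simp: word_def monomial_def)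
next
  case (Cons a as)
  then show ?case by (simp add: word_def vmult_def)
qed

lemma word_Nil: "word [] = monomial {}"
  by (simp add: word_def)

lemma word_Cons: "word (a # as) = left_mult a (word as)"
  using vmult_monomial[of "word as" a] word_infinite by (simp add: word_def)

lemma word_support: "word as U \<noteq> 0 \<Longrightarrow> U \<subseteq> set as"
proof (induction as arbitrary: U)
  case (Cons a as)
  then have "a \<in> U" "word as (U - {a}) \<noteq> 0"
    by (auto simp: word_Cons left_mult_def split: if_splits)
  then show ?case using Cons.IH[of "U - {a}"] by auto
qed (auto simp: word_Nil monomial_def split: if_splits)

lemma left_mult_word_member: "a \<in> set as \<Longrightarrow> left_mult a (word as) = (\<lambda>U. 0)"
proof (induction as)
  case (Cons b as)
  show ?case
  proof (cases "a = b")
    case False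
    then have "left_mult b (left_mult a (word as)) = (\<lambda>U. 0)"
      using Cons by (auto simp: left_mult_def)
    then show ?thesis by (simp add: word_Cons left_mult_commute[of a b])
  qed (simp add: word_Cons left_mult_left_mult_self)
qed simp

lemma word_not_distinct: "\<not> distinct as \<Longrightarrow> word as = (\<lambda>U. 0)"
proof (induction as)
  case (Cons a as)
  then show ?case
    by (cases "a \<in> set as") (auto simp: word_Cons left_mult_word_member left_mult_zero)
qed simp

lemma word_strictly_sorted: "sorted_wrt (<) as \<Longrightarrow> word as = monomial (set as)"
proof (induction as)
  case (Cons a as)
  have a: "a \<notin> set as" using Cons.prems by auto
  have "left_mult a (monomial (set as)) U = monomial (insert a (set as)) U" for U
  proof (cases "U = insert a (set as)")
    case True
    then have "{t \<in> U. t < a} = {}" using Cons.prems by auto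
    then show ?thesis using a True by (simp only: left_mult_def monomial_def) simp
  next
    case False
    then have "a \<in> U \<Longrightarrow> U - {a} \<noteq> set as" by blast
    then show ?thesis using False by (simp add: left_mult_def monomial_def)
  qed
  then have "left_mult a (monomial (set as)) = monomial (insert a (set as))" ..
  then show ?case using Cons by (simp add: word_Cons)
qed (simp add: word_Nil)

lemma word_sorted_list_of_set: "finite S \<Longrightarrow> word (sorted_list_of_set S) = monomial S"
  by (simp add: word_strictly_sorted)

text \<open>
  The power of \<open>\<xi>\<close> must not depend on \<open>f\<close>: this is what makes a
  substitution of circles well defined on monomials, no matter how it permutes or identifies
  them.
\<close>

lemma word_insort:
  "\<exists>k. \<forall>f. word (map f (a # as)) = (\<lambda>U. xi ^ k * word (map f (insort a as)) U)"
proof (induction as)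
  case Nil
  show ?case by (intro exI[of _ 0] allI) simp
next
  case (Cons b as)
  then obtain k where k: "\<forall>f. word (map f (a # as)) = (\<lambda>U. xi ^ k * word (map f (insort a as)) U)" ..
  show ?case
  proof (cases "a \<le> b")
    case True
    then have "insort a (b # as) = a # b # as" by simp
    then show ?thesis by (intro exI[of _ 0] allI) simp
  next
    case False
    then have insort: "insort a (b # as) = b # insort a as" by simp
    show ?thesis
    proof (intro exI[of _ "Suc k"] allI)
      fix f
      have "word (map f (a # b # as)) = (\<lambda>U. xi * left_mult (f b) (word (map f (a # as))) U)"
        by (simp add: word_Cons left_mult_commute[of "f a" "f b"])
      also have "word (map f (a # as)) = (\<lambda>U. xi ^ k * word (map f (insort a as)) U)" using k ..
      also have "(\<lambda>U. xi * left_mult (f b) (\<lambda>U. xi ^ k * word (map f (insort a as)) U) U) =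
          (\<lambda>U. xi ^ Suc k * word (map f (insort a (b # as))) U)"
        by (simp only: insort left_mult_scale list.map word_Cons power_Suc mult.assoc)
      finally show "word (map f (a # b # as)) = (\<lambda>U. xi ^ Suc k * word (map f (insort a (b # as))) U)" .
    qed
  qed
qed

lemma word_sort: "\<exists>k. \<forall>f. word (map f as) = (\<lambda>U. xi ^ k * word (map f (sort as)) U)"
proof (induction as)
  case Nil
  show ?case by (intro exI[of _ 0] allI) simp
next
  case (Cons a as)
  then obtain k where k: "\<forall>f. word (map f as) = (\<lambda>U. xi ^ k * word (map f (sort as)) U)" ..
  obtain j where j: "\<forall>f. word (map f (a # sort as)) = (\<lambda>U. xi ^ j * word (map f (insort a (sort as))) U)"
    using word_insort[of a "sort as"] ..
  show ?case
  proof (intro exI[of _ "k + j"] allI)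
    fix f
    have "word (map f (a # as)) = left_mult (f a) (word (map f as))" by (simp add: word_Cons)
    also have "word (map f as) = (\<lambda>U. xi ^ k * word (map f (sort as)) U)" using k ..
    also have "left_mult (f a) \<dots> = (\<lambda>U. xi ^ k * word (map f (a # sort as)) U)"
      by (simp add: word_Cons left_mult_scale)
    also have "word (map f (a # sort as)) = (\<lambda>U. xi ^ j * word (map f (insort a (sort as))) U)"
      using j ..
    finally show "word (map f (a # as)) = (\<lambda>U. xi ^ (k + j) * word (map f (sort (a # as))) U)"
      by (simp add: power_add mult.assoc)
  qed
qed

definition extend_linearly :: "nat set \<Rightarrow> (nat set \<Rightarrow> valg) \<Rightarrow> valg \<Rightarrow> valg"
  where "extend_linearly C E x = (\<lambda>U. \<Sum>S\<in>Pow C. x S * E S U)"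

lemma extend_linearly_add:
  "extend_linearly C E (\<lambda>S. x S + y S) = (\<lambda>U. extend_linearly C E x U + extend_linearly C E y U)"
  by (simp add: extend_linearly_def distrib_right sum.distrib)

lemma extend_linearly_scale: "extend_linearly C E (\<lambda>S. c * x S) = (\<lambda>U. c * extend_linearly C E x U)"
  by (simp add: extend_linearly_def mult.assoc sum_distrib_left)

lemma extend_linearly_monomial:
  assumes "finite C" "S \<subseteq> C" shows "extend_linearly C E (monomial S) = E S"
proof
  fix U
  have "extend_linearly C E (monomial S) U = (\<Sum>T\<in>{S}. monomial S T * E T U)"
    unfolding extend_linearly_def using assms
    by (intro sum.mono_neutral_right) (auto simp: monomial_def)
  then show "extend_linearly C E (monomial S) U = E S U" by (simp add: monomial_def)
qed

text \<open>
  Edge maps are prescribed on sorted monomials only. This computes them on arbitrary products: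
  sorting the factors costs the same power of \<open>\<xi>\<close> before and after the
  substitution \<open>f\<close>, and a product with a repeated factor vanishes on both sides.
  The map \<open>\<Phi>\<close> will be the identity for a merge and multiplication by
  \<open>a\<^sub>1 + \<xi> a\<^sub>2\<close> for a split.
\<close>

lemma extend_linearly_word:
  assumes scale: "\<And>c x. \<Phi> (\<lambda>U. c * x U) = (\<lambda>U. c * \<Phi> x U)"
    and C: "finite C" "set as \<subseteq> C"
  shows "extend_linearly C (\<lambda>S. \<Phi> (alg_map f S)) (word as) = \<Phi> (word (map f as))"
proof (cases "distinct as")
  case True
  obtain k where k: "\<forall>f. word (map f as) = (\<lambda>U. xi ^ k * word (map f (sort as)) U)"
    using word_sort[of as] ..
  have s: "sort as = sorted_list_of_set (set as)"
    using True by (simp add: sorted_list_of_set_sort_remdups distinct_remdups_id)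
  have "word as = (\<lambda>U. xi ^ k * monomial (set as) U)"
    using k[rule_format, of id] s by (simp add: word_sorted_list_of_set)
  then show ?thesis
    using C by (simp add: extend_linearly_scale extend_linearly_monomial alg_map_def k[rule_format, of f] s scale)
next
  case False
  then have "\<not> distinct (map f as)" by (auto simp: distinct_map)
  moreover have "\<Phi> (\<lambda>U. 0) = (\<lambda>U. 0)" using scale[of 0 "\<lambda>U. 0"] by simp
  ultimately show ?thesis using False by (simp add: word_not_distinct extend_linearly_def)
qed

text \<open>
  Multiplication from the left by \<open>a + \<xi> b\<close>, the factor introduced by a split.
\<close>

definition split_mult :: "nat \<Rightarrow> nat \<Rightarrow> valg \<Rightarrow> valg"
  where "split_mult a b y = (\<lambda>U. left_mult a y U + xi * left_mult b y U)"

lemma vmult_split: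
  assumes "\<And>U. infinite U \<Longrightarrow> y U = 0"
  shows "vmult (\<lambda>T. monomial {a} T + xi * monomial {b} T) y = split_mult a b y"
proof -
  have "vmult (\<lambda>T. monomial {a} T + xi * monomial {b} T) y =
      (\<lambda>U. vmult (monomial {a}) y U + xi * vmult (monomial {b}) y U)"
    by (simp add: vmult_def algebra_simps sum.distrib sum_distrib_left)
  then show ?thesis by (simp add: vmult_monomial[OF assms] split_mult_def)
qed

lemma split_mult_scale: "split_mult a b (\<lambda>U. c * x U) = (\<lambda>U. c * split_mult a b x U)"
  by (simp add: split_mult_def left_mult_scale algebra_simps)

lemma split_mult_left_mult:
  "split_mult a b (left_mult c y) = (\<lambda>U. xi * left_mult c (split_mult a b y) U)"
  by (simp add: split_mult_def left_mult_add left_mult_scale left_mult_commute[of a c]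
      left_mult_commute[of b c] algebra_simps)

lemma split_mult_left_mult_eq: "split_mult a b (left_mult a y) = split_mult a b (left_mult b y)"
  by (simp add: split_mult_def left_mult_left_mult_self left_mult_commute[of a b] xi_square_left)

text \<open>
  After multiplication by \<open>a + \<xi> b\<close> the circles \<open>a\<close> and
  \<open>b\<close> become interchangeable, since
  \<open>(a + \<xi> b) a = \<xi> b a = a b = (a + \<xi> b) b\<close>. This is why the split
  circle may be replaced by either of its two parts, even by different ones in different
  factors.
\<close>

lemma split_mult_word_cong:
  assumes "\<And>e. e \<in> set es \<Longrightarrow> h e = h' e \<or> {h e, h' e} \<subseteq> {a, b}"
  shows "split_mult a b (word (map h es)) = split_mult a b (word (map h' es))"
  using assms
proof (induction es)
  case (Cons e es)
  have "split_mult a b (word (map h (e # es))) =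
      (\<lambda>U. xi * left_mult (h e) (split_mult a b (word (map h es))) U)"
    by (simp add: word_Cons split_mult_left_mult)
  also have "\<dots> = split_mult a b (left_mult (h e) (word (map h' es)))"
    using Cons by (simp add: split_mult_left_mult)
  also have "\<dots> = split_mult a b (left_mult (h' e) (word (map h' es)))"
    using Cons.prems[of e] split_mult_left_mult_eq[of a b "word (map h' es)"] by auto
  finally show ?case by (simp add: word_Cons)
qed simp

lemma split_mult_add: "split_mult a b (\<lambda>U. x U + y U) = (\<lambda>U. split_mult a b x U + split_mult a b y U)"
  by (simp add: split_mult_def left_mult_add algebra_simps)

lemma split_mult_commute:
  "split_mult a b (split_mult c d y) = (\<lambda>U. xi * split_mult c d (split_mult a b y) U)"
proof -
  have "split_mult a b (split_mult c d y) =
      (\<lambda>U. split_mult a b (left_mult c y) U + xi * split_mult a b (left_mult d y) U)"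
    by (subst split_mult_def[of c d]) (simp add: split_mult_add split_mult_scale)
  also have "\<dots> = (\<lambda>U. xi * (left_mult c (split_mult a b y) U + xi * left_mult d (split_mult a b y) U))"
    by (simp add: split_mult_left_mult algebra_simps)
  finally show ?thesis by (simp add: split_mult_def[of c d])
qed

lemma split_mult_swap: "split_mult b a y = (\<lambda>U. xi * split_mult a b y U)"
  by (simp add: split_mult_def algebra_simps xi_square_left)

section \<open>Cycles of a permutation and transpositions\<close>

definition graph_on :: "('a \<Rightarrow> 'a) \<Rightarrow> 'a set \<Rightarrow> ('a \<times> 'a) set"
  where "graph_on s H = {(h, s h) | h. h \<in> H}"

lemma graph_onI: "h \<in> H \<Longrightarrow> (h, s h) \<in> graph_on s H"
  by (auto simp: graph_on_def)

lemma funpow_in: "bij_betw s H H \<Longrightarrow> x \<in> H \<Longrightarrow> (s ^^ n) x \<in> H"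
  by (induction n) (auto dest: bij_betwE)

lemma funpow_graph_on:
  assumes "bij_betw s H H" "x \<in> H" shows "(x, (s ^^ n) x) \<in> (graph_on s H)\<^sup>*"
proof (induction n)
  case (Suc n)
  have "((s ^^ n) x, (s ^^ Suc n) x) \<in> graph_on s H"
    using funpow_in[OF assms, of n] by (auto simp: graph_on_def)
  then show ?case using Suc by (rule rtrancl_into_rtrancl[rotated])
qed simp

lemma rtrancl_graph_on_closed:
  assumes "(x, z) \<in> (graph_on s H)\<^sup>*" "x \<in> Q" "\<And>q. q \<in> Q \<Longrightarrow> s q \<in> Q"
  shows "z \<in> Q"
  using assms(1) by (induction rule: rtrancl_induct) (use assms(2,3) in \<open>auto simp: graph_on_def\<close>)

lemma funpow_return:
  assumes "finite H" "bij_betw s H H" "x \<in> H"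
  obtains n where "0 < n" "(s ^^ n) x = x"
proof -
  have "range (\<lambda>n. (s ^^ n) x) \<subseteq> H" using funpow_in[OF assms(2,3)] by auto
  then have "\<not> inj (\<lambda>n. (s ^^ n) x)"
    using assms(1) finite_subset range_inj_infinite by blast
  then obtain k l where kl: "k < l" "(s ^^ k) x = (s ^^ l) x"
    by (metis (mono_tags, lifting) injI linorder_neqE_nat)
  have "(s ^^ k) ((s ^^ (l - k)) x) = (s ^^ k) x"
    using kl fun_cong[OF funpow_add[of k "l - k" s], of x] by simp
  moreover have "inj_on (s ^^ k) H" using bij_betw_funpow[OF assms(2)] by (simp add: bij_betw_def)
  ultimately have "(s ^^ (l - k)) x = x"
    using funpow_in[OF assms(2,3)] assms(3) by (meson inj_onD)
  then show ?thesis using kl(1) that[of "l - k"] by simp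
qed

text \<open>
  The cycles of a permutation of a finite set are closed under going backwards, as one returns
  by going forwards around the cycle.
\<close>

lemma rtrancl_graph_on_converse:
  assumes "finite H" "bij_betw s H H"
  shows "(graph_on s H \<union> (graph_on s H)\<inverse>)\<^sup>* = (graph_on s H)\<^sup>*"
proof -
  have "(s h, h) \<in> (graph_on s H)\<^sup>*" if "h \<in> H" for h
  proof -
    obtain n where "0 < n" "(s ^^ n) h = h" using funpow_return[OF assms \<open>h \<in> H\<close>] .
    then have "(s ^^ (n - 1)) (s h) = h" by (metis Suc_diff_1 comp_apply funpow_Suc_right)
    then show ?thesis
      using funpow_graph_on[OF assms(2), of "s h" "n - 1"] that assms(2) by (auto dest: bij_betwE)
  qed
  then have "(graph_on s H)\<inverse> \<subseteq> (graph_on s H)\<^sup>*" by (auto simp: graph_on_def)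
  then show ?thesis
    by (metis (no_types, lifting) Un_subset_iff r_into_rtrancl rtrancl_subset subsetI sup_ge1)
qed

text \<open>
  Multiplying a permutation by a transposition of \<open>x\<close> and \<open>y\<close> either
  cuts their common cycle into two or glues their two cycles together. Follow \<open>s\<close>
  from \<open>x\<close> until it first hits \<open>{x, y}\<close> again. Up to that moment
  \<open>f\<close> agrees with \<open>s\<close>; then, if \<open>s\<close> arrives at
  \<open>y\<close>, \<open>f\<close> closes up at \<open>x\<close> without having met
  \<open>y\<close>, and vice versa.
\<close>

lemma same_cycle_transposition:
  assumes H: "finite H" "bij_betw s H H" "x \<in> H" and "x \<noteq> y"
    and f: "\<And>h. h \<in> H \<Longrightarrow> f h = (if s h = x then y else if s h = y then x else s h)"
  shows "(x, y) \<in> (graph_on s H)\<^sup>* \<longleftrightarrow> (x, y) \<notin> (graph_on f H)\<^sup>*"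
proof -
  \<comment> \<open>The number of steps after which \<open>s\<close> first returns from \<open>x\<close> to \<open>{x, y}\<close>.\<close>
  define n where "n = (LEAST n. 0 < n \<and> (s ^^ n) x \<in> {x, y})"
  have "\<exists>n. 0 < n \<and> (s ^^ n) x \<in> {x, y}" using funpow_return[OF H] by blast
  then have n: "0 < n" "(s ^^ n) x \<in> {x, y}"
    unfolding n_def by (metis (mono_tags, lifting) LeastI_ex)+
  have before: "(s ^^ k) x \<notin> {x, y}" if "0 < k" "k < n" for k
    using not_less_Least[of k "\<lambda>n. 0 < n \<and> (s ^^ n) x \<in> {x, y}"] that by (auto simp: n_def)
  have in_H: "(s ^^ k) x \<in> H" for k using funpow_in[OF H(2,3)] .
  define Q where "Q = (\<lambda>k. (s ^^ k) x) ` {..<n}"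
  have Q: "x \<in> Q" "y \<notin> Q" "Q \<subseteq> H"
  proof -
    show "x \<in> Q" unfolding Q_def using n(1) by (intro image_eqI[of _ _ 0]) auto
    show "y \<notin> Q"
    proof
      assume "y \<in> Q"
      then obtain k where "k < n" "(s ^^ k) x = y" by (auto simp: Q_def)
      then show False using before[of k] \<open>x \<noteq> y\<close> by (cases "k = 0") auto
    qed
    show "Q \<subseteq> H" using in_H by (auto simp: Q_def)
  qed
  have closed: "g q \<in> Q" if q: "q \<in> Q" and last: "g ((s ^^ (n - 1)) x) = x"
    and other: "\<And>k. Suc k < n \<Longrightarrow> g ((s ^^ k) x) = (s ^^ Suc k) x" for g q
  proof -
    obtain k where k: "k < n" "q = (s ^^ k) x" using q by (auto simp: Q_def)
    show ?thesis
    proof (cases "Suc k < n")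
      case True
      then show ?thesis using other[of k] k(2) by (auto simp: Q_def intro!: image_eqI[of _ _ "Suc k"])
    next
      case False
      then have "k = n - 1" using k(1) by simp
      then show ?thesis using last k(2) Q(1) by simp
    qed
  qed
  have f_step: "f ((s ^^ k) x) = (s ^^ Suc k) x" if "Suc k < n" for k
    using f[OF in_H[of k]] before[of "Suc k"] that by auto
  have s_last: "s ((s ^^ (n - 1)) x) = (s ^^ n) x" using n(1) by (cases n) auto
  from n(2) consider "(s ^^ n) x = y" | "(s ^^ n) x = x" by auto
  then show ?thesis
  proof cases
    case 1
    then have "f ((s ^^ (n - 1)) x) = x" using f[OF in_H[of "n - 1"]] s_last \<open>x \<noteq> y\<close> by auto
    then have "(x, y) \<notin> (graph_on f H)\<^sup>*"
      using rtrancl_graph_on_closed[of x y f H Q] Q closed[of _ f] f_step by blast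
    then show ?thesis using funpow_graph_on[OF H(2,3), of n] 1 by simp
  next
    case 2
    then have "(x, y) \<notin> (graph_on s H)\<^sup>*"
      using rtrancl_graph_on_closed[of x y s H Q] Q closed[of _ s] s_last by auto
    moreover have "(x, (s ^^ k) x) \<in> (graph_on f H)\<^sup>*" if "k < n" for k
      using that
    proof (induction k)
      case (Suc k)
      have "((s ^^ k) x, (s ^^ Suc k) x) \<in> graph_on f H"
        using f_step[OF Suc.prems] in_H[of k] by (auto simp: graph_on_def)
      then show ?case using Suc by (auto intro: rtrancl_into_rtrancl)
    qed simp
    moreover have "((s ^^ (n - 1)) x, y) \<in> graph_on f H"
      using f[OF in_H[of "n - 1"]] s_last 2 in_H[of "n - 1"] by (auto simp: graph_on_def)
    ultimately show ?thesis using n(1) by (meson diff_less rtrancl_into_rtrancl zero_less_one)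
  qed
qed

section \<open>Checkerboard colourings of planar diagrams\<close>

lemma bit_cases: "(b::bit) = 0 \<or> b = 1"
  by (cases b) auto

text \<open>
  These rules would turn the field operations into bitwise ones, where the laws of a ring are no
  longer recognised.
\<close>

declare add_bit_eq_xor [simp del] mult_bit_eq_and [simp del]

lemma bit_add_eq_1_iff: "(a::bit) + b = 1 \<longleftrightarrow> a \<noteq> b"
  using bit_cases[of a] bit_cases[of b] by auto

lemma bit_add_eq_0_iff: "(a::bit) + b = 0 \<longleftrightarrow> a = b"
  using bit_cases[of a] bit_cases[of b] by auto

lemma bit_add_same: "(a::bit) + a = 0"
  by (simp add: bit_add_eq_0_iff)

lemma bit_cyclic_sum: "(w + x) + (x + y) + (y + z) + (z + w) = (0::bit)"
  using bit_cases[of w] bit_cases[of x] bit_cases[of y] bit_cases[of z] by auto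

definition bit_functions :: "'a set \<Rightarrow> ('a \<Rightarrow> bit) set"
  where "bit_functions A = {f. \<forall>x. x \<notin> A \<longrightarrow> f x = 0}"

lemma card_bit_functions:
  assumes "finite A" shows "finite (bit_functions A)" "card (bit_functions A) = 2 ^ card A"
proof -
  have "bij_betw (\<lambda>f. {x. f x = 1}) (bit_functions A) (Pow A)"
  proof (rule bij_betw_byWitness[where f' = "\<lambda>X x. of_bool (x \<in> X)"])
    show "\<forall>f\<in>bit_functions A. (\<lambda>x. of_bool (x \<in> {x. f x = 1})) = f"
    proof (intro ballI ext)
      fix f :: "'a \<Rightarrow> bit" and x
      show "of_bool (x \<in> {x. f x = 1}) = f x" using bit_cases[of "f x"] by auto
    qed
  qed (auto simp: bit_functions_def)
  then show "finite (bit_functions A)" "card (bit_functions A) = 2 ^ card A"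
    using assms by (auto simp: bij_betw_finite bij_betw_same_card card_Pow)
qed

text \<open>
  The cardinality form of the rank-nullity theorem over the field with two elements: every
  nonempty fibre is a translate of the kernel.
\<close>

lemma card_kernel_image:
  fixes G :: "('a \<Rightarrow> bit) set" and f :: "('a \<Rightarrow> bit) \<Rightarrow> 'b \<Rightarrow> bit"
  assumes G: "finite G" "\<And>x y. x \<in> G \<Longrightarrow> y \<in> G \<Longrightarrow> (\<lambda>a. x a + y a) \<in> G"
    and f: "\<And>x y. f (\<lambda>a. x a + y a) = (\<lambda>b. f x b + f y b)"
  shows "card G = card {x \<in> G. f x = (\<lambda>b. 0)} * card (f ` G)"
proof -
  have "card {x \<in> G. f x = f x0} = card {x \<in> G. f x = (\<lambda>b. 0)}" if x0: "x0 \<in> G" for x0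
  proof -
    have "bij_betw (\<lambda>x a. x a + x0 a) {x \<in> G. f x = f x0} {x \<in> G. f x = (\<lambda>b. 0)}"
      by (rule bij_betw_byWitness[where f' = "\<lambda>x a. x a + x0 a"])
        (use x0 in \<open>auto simp: f G(2) add.assoc bit_add_same\<close>)
    then show ?thesis by (rule bij_betw_same_card)
  qed
  then have "(\<Sum>y\<in>f ` G. card {x \<in> G. f x = y}) = (\<Sum>y\<in>f ` G. card {x \<in> G. f x = (\<lambda>b. 0)})"
    by (intro sum.cong) auto
  moreover have "card G = (\<Sum>y\<in>f ` G. card {x \<in> G. f x = y})"
    using sum.image_gen[OF G(1), of "\<lambda>x. 1::nat" f] by simp
  ultimately show ?thesis by simp
qed

definition component_of :: "'a set \<Rightarrow> ('a \<times> 'a) set \<Rightarrow> 'a \<Rightarrow> 'a set"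
  where "component_of A r x = {y. x \<in> A \<and> y \<in> A \<and> (x, y) \<in> (r \<union> r\<inverse>)\<^sup>*}"

lemma components_eq: "components A r = component_of A r ` A"
  by (auto simp: components_def component_of_def quotient_def)

lemma component_of_eq_iff:
  assumes "x \<in> A" "y \<in> A"
  shows "component_of A r x = component_of A r y \<longleftrightarrow> (x, y) \<in> (r \<union> r\<inverse>)\<^sup>*"
proof -
  have "sym ((r \<union> r\<inverse>)\<^sup>*)" by (intro sym_rtrancl) (auto simp: sym_def)
  then show ?thesis
    using assms by (auto simp: component_of_def set_eq_iff dest: symD intro: rtrancl_trans)
qed

lemma component_of_step: "(x, y) \<in> r \<Longrightarrow> x \<in> A \<Longrightarrow> y \<in> A \<Longrightarrow> component_of A r x = component_of A r y"
  by (auto simp: component_of_eq_iff)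

lemma finite_darts: "finite (darts D)"
  by (simp add: darts_def)

lemma darts_eq: "darts D = incoming D \<union> outgoing D"
  and incoming_outgoing_disjoint: "incoming D \<inter> outgoing D = {}"
  by (auto simp: darts_def incoming_def outgoing_def split: if_splits)

text \<open>
  Each label of a crossing strand occurs once among the incoming and once among the outgoing
  darts.
\<close>

lemma other_end_ex1:
  assumes D: "planar_diagram D" and p: "p \<in> darts D"
  shows "\<exists>!q. q \<in> darts D \<and> q \<noteq> p \<and> label D q = label D p"
proof -
  have inj: "inj_on (label D) (incoming D)" "inj_on (label D) (outgoing D)"
    and eq: "label D ` incoming D = label D ` outgoing D"
    using D by (auto simp: planar_diagram_def)
  have "\<exists>!q. q \<in> darts D \<and> q \<noteq> p \<and> label D q = label D p"
    if A: "p \<in> A" "inj_on (label D) A" "inj_on (label D) B" "label D ` A = label D ` B"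
      "darts D = A \<union> B" "A \<inter> B = {}" for A B
  proof -
    have "label D p \<in> label D ` B" using A by auto
    then obtain q where q: "q \<in> B" "label D q = label D p" by force
    show ?thesis
    proof (rule ex1I[of _ q])
      show "q \<in> darts D \<and> q \<noteq> p \<and> label D q = label D p" using A q by auto
      fix q' assume "q' \<in> darts D \<and> q' \<noteq> p \<and> label D q' = label D p"
      then show "q' = q" using A q by (metis UnE inj_onD)
    qed
  qed
  from this[of "incoming D" "outgoing D"] this[of "outgoing D" "incoming D"]
  show ?thesis using p inj eq darts_eq[of D] incoming_outgoing_disjoint[of D] by blast
qed

lemma other_end:
  assumes "planar_diagram D" "p \<in> darts D"
  shows "other_end D p \<in> darts D" "other_end D p \<noteq> p" "label D (other_end D p) = label D p"
  using theI'[OF other_end_ex1[OF assms]] by (auto simp: other_end_def)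

lemma other_end_eqI:
  assumes "planar_diagram D" "p \<in> darts D" "q \<in> darts D" "q \<noteq> p" "label D q = label D p"
  shows "other_end D p = q"
  using other_end_ex1[OF assms(1,2)] other_end[OF assms(1,2)] assms(3-5) by blast

lemma other_end_other_end:
  assumes "planar_diagram D" "p \<in> darts D" shows "other_end D (other_end D p) = p"
  using other_end[OF assms] assms by (intro other_end_eqI) auto

lemma darts_same_label:
  assumes "planar_diagram D" "p \<in> darts D"
  shows "{q \<in> darts D. label D q = label D p} = {p, other_end D p}"
  using other_end[OF assms] other_end_eqI[OF assms] assms(2) by blast

lemma rot_darts: "p \<in> darts D \<Longrightarrow> rot p \<in> darts D"
  by (auto simp: rot_def darts_def)

lemma rot_cycle: "rot (c, 0) = (c, 1)" "rot (c, 1) = (c, 2)" "rot (c, 2) = (c, 3)" "rot (c, 3) = (c, 0)"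
  by (simp_all add: rot_def)

lemma darts_at_crossing: "c < ncross D \<Longrightarrow> {p \<in> darts D. fst p = c} = Pair c ` {..<4}"
  by (auto simp: darts_def)

text \<open>
  A checkerboard colouring of the faces, recorded on darts by the colour of the face to which
  the dart belongs; this is the form in which planarity enters.

  Work over the field with two elements. A set of faces has a coboundary, the set of edges that
  have it on exactly one side, and what is wanted is a set of faces whose coboundary consists of
  all edges. Coboundaries are cycles of the four-valent graph, and the set of all edges is a
  cycle because all valences are even. So it suffices that every cycle is a coboundary, and this
  follows from a count. With \<open>V\<close>, \<open>E\<close>, \<open>F\<close>,
  \<open>K\<close> the numbers of vertices, edges, faces and components, the coboundary map has
  a kernel of dimension at most \<open>K\<close>, and the boundary map from edges to vertices
  has a cokernel of dimension at most \<open>K\<close>. Hence the coboundaries have dimension at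
  least \<open>F - K\<close> and the cycles at most \<open>E - V + K\<close>, and these numbers
  agree by Euler's formula.
\<close>

lemma checkerboard_colouring:
  assumes D: "planar_diagram D"
  shows "\<exists>col :: dart \<Rightarrow> bool. \<forall>p\<in>darts D. col (other_end D p) \<noteq> col p \<and> col (rot p) \<noteq> col p"
proof -
  define n where "n = ncross D"
  define E where "E = label D ` darts D"
  define face_rel where "face_rel = {(p, rot (other_end D p)) | p. p \<in> darts D}"
  define graph_rel where "graph_rel = {(fst p, fst (other_end D p)) | p. p \<in> darts D}"
  define face where "face = component_of (darts D) face_rel"
  define comp where "comp = component_of {..<n} graph_rel"
  have faces: "faces D = face ` darts D"
    by (simp add: faces_def components_eq face_def face_rel_def)
  have graph: "graph_components D = comp ` {..<n}"
    by (simp add: graph_components_def components_eq comp_def graph_rel_def n_def)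
  note oe = other_end[OF D] and oe2 = other_end_other_end[OF D]
  have fst_dart: "fst p < n" if "p \<in> darts D" for p using that by (auto simp: darts_def n_def)
  have finE: "finite E" by (simp add: E_def finite_darts)
  have finF: "finite (faces D)" by (simp add: faces finite_darts)
  have finK: "finite (graph_components D)" by (simp add: graph)
  have euler: "n + card (faces D) = card E + 2 * card (graph_components D)"
    using D by (simp add: planar_diagram_def n_def E_def)

  have face_rot: "face (rot p) = face (other_end D p)" if "p \<in> darts D" for p
  proof -
    have "(other_end D p, rot p) \<in> face_rel"
      using oe(1)[OF that] oe2[OF that] unfolding face_rel_def
      by (intro CollectI exI[of _ "other_end D p"]) simp
    then show ?thesis unfolding face_def
      using component_of_step[of "other_end D p" "rot p"] oe(1)[OF that] rot_darts[OF that] by simp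
  qed

  \<comment> \<open>The coboundary from faces to edges and the boundary from edges to crossings. A label occurs on
    two darts and a face may lie on both sides of an edge, so these are sums over darts.\<close>
  define \<delta> :: "(dart set \<Rightarrow> bit) \<Rightarrow> nat \<Rightarrow> bit"
    where "\<delta> = (\<lambda>a e. \<Sum>p\<in>{p \<in> darts D. label D p = e}. a (face p))"
  define boundary :: "(nat \<Rightarrow> bit) \<Rightarrow> nat \<Rightarrow> bit"
    where "boundary = (\<lambda>z c. \<Sum>p\<in>{p \<in> darts D. fst p = c}. z (label D p))"
  have \<delta>_add: "\<delta> (\<lambda>a. x a + y a) = (\<lambda>b. \<delta> x b + \<delta> y b)" for x y
    by (simp add: \<delta>_def sum.distrib)
  have boundary_add: "boundary (\<lambda>a. x a + y a) = (\<lambda>b. boundary x b + boundary y b)" for x y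
    by (simp add: boundary_def sum.distrib)
  have \<delta>_label: "\<delta> a (label D p) = a (face p) + a (face (other_end D p))" if "p \<in> darts D" for a p
    using darts_same_label[OF D that] oe(2)[OF that] by (simp add: \<delta>_def)
  have \<delta>_E: "\<delta> a \<in> bit_functions E" for a
    by (auto simp: bit_functions_def \<delta>_def E_def intro!: sum.neutral)
  have sum_crossing: "(\<Sum>p\<in>{p \<in> darts D. fst p = c}. g p) = g (c, 0) + g (c, 1) + g (c, 2) + g (c, 3)"
    if "c < n" for g :: "dart \<Rightarrow> bit" and c
    using that darts_at_crossing[of c D]
    by (simp add: n_def sum.reindex inj_on_def lessThan_nat_numeral lessThan_Suc add.commute add.left_commute)
  have no_darts: "{p \<in> darts D. fst p = c} = {}" if "\<not> c < n" for c
    using that fst_dart by auto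

  have boundary_\<delta>: "boundary (\<delta> a) = (\<lambda>c. 0)" for a
  proof
    fix c
    show "boundary (\<delta> a) c = 0"
    proof (cases "c < n")
      case True
      have "boundary (\<delta> a) c = (\<Sum>p\<in>{p \<in> darts D. fst p = c}. a (face p) + a (face (rot p)))"
        unfolding boundary_def by (intro sum.cong) (auto simp: \<delta>_label face_rot)
      also have "\<dots> = 0"
        unfolding sum_crossing[OF True] rot_cycle by (rule bit_cyclic_sum)
      finally show ?thesis .
    next
      case False
      then show ?thesis by (simp add: boundary_def no_darts)
    qed
  qed

  \<comment> \<open>One crossing in each component of the graph; there are at most \<open>K\<close> of them.\<close>
  define rep where "rep = (\<lambda>c. SOME c'. c' \<in> comp c)"
  define R where "R = rep ` {..<n}"
  have comp_self: "c \<in> comp c" if "c < n" for c using that by (auto simp: comp_def component_of_def)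
  have rep: "rep c < n" "(c, rep c) \<in> (graph_rel \<union> graph_rel\<inverse>)\<^sup>*" if "c < n" for c
    using someI[of "\<lambda>c'. c' \<in> comp c", OF comp_self[OF that]]
    by (auto simp: rep_def comp_def component_of_def)
  have finR: "finite R" by (simp add: R_def)
  have cardR: "card R \<le> card (graph_components D)"
  proof -
    have "R = (\<lambda>C. SOME c'. c' \<in> C) ` graph_components D" by (auto simp: R_def rep_def graph)
    then show ?thesis using finK by (simp add: card_image_le)
  qed

  \<comment> \<open>A function on the faces in the kernel takes the same value on adjacent faces, so it is determined
    by its values at the chosen crossings.\<close>
  have kernel: "card {a \<in> bit_functions (faces D). \<delta> a = (\<lambda>e. 0)} \<le> 2 ^ card R" (is "card ?ker \<le> _")
  proof -
    have const: "a (face p) = a (face q)"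
      if a: "a \<in> ?ker" and pq: "p \<in> darts D" "q \<in> darts D" "(fst p, fst q) \<in> (graph_rel \<union> graph_rel\<inverse>)\<^sup>*"
      for a p q
    proof -
      have oe_eq: "a (face (other_end D p)) = a (face p)" if "p \<in> darts D" for p
        using a \<delta>_label[OF that, of a] by (simp add: bit_add_eq_0_iff)
      have rot_eq: "a (face (rot p)) = a (face p)" if "p \<in> darts D" for p
        using oe_eq[OF that] face_rot[OF that] by simp
      have crossing: "a (face (c, k)) = a (face (c, 0))" if "c < n" "k < 4" for c k
      proof -
        have "a (face (c, 1)) = a (face (c, 0))" "a (face (c, 2)) = a (face (c, 1))"
          "a (face (c, 3)) = a (face (c, 2))"
          using rot_eq[of "(c, 0)"] rot_eq[of "(c, 1)"] rot_eq[of "(c, 2)"] that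
          by (simp_all only: rot_cycle) (simp_all add: darts_def n_def)
        moreover have "k = 0 \<or> k = 1 \<or> k = 2 \<or> k = 3" using that by linarith
        ultimately show ?thesis by auto
      qed
      have dart: "a (face p) = a (face (fst p, 0))" if "p \<in> darts D" for p
        using crossing[of "fst p" "snd p"] that by (auto simp: darts_def n_def)
      have step: "a (face (c, 0)) = a (face (c', 0))" if "(c, c') \<in> graph_rel" for c c'
      proof -
        obtain p where "p \<in> darts D" "c = fst p" "c' = fst (other_end D p)"
          using \<open>(c, c') \<in> graph_rel\<close> by (auto simp: graph_rel_def)
        then show ?thesis using dart[of p] dart[of "other_end D p"] oe(1)[of p] oe_eq[of p] by simp
      qed
      have "a (face (fst p, 0)) = a (face (fst q, 0))"
        using pq(3) by (induction rule: rtrancl_induct) (use step in auto)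
      then show ?thesis using dart pq(1,2) by simp
    qed
    define restrict where "restrict = (\<lambda>(a :: dart set \<Rightarrow> bit) c. if c \<in> R then a (face (c, 0)) else 0)"
    have inj: "inj_on restrict ?ker"
    proof (rule inj_onI, rule ext)
      fix a b C assume a: "a \<in> ?ker" and b: "b \<in> ?ker" and eq: "restrict a = restrict b"
      show "a C = b C"
      proof (cases "C \<in> faces D")
        case True
        then obtain p where p: "p \<in> darts D" "C = face p" by (auto simp: faces)
        define c where "c = fst p"
        have c: "c < n" using p(1) fst_dart by (simp add: c_def)
        have "(rep c, 0) \<in> darts D" using rep(1)[OF c] by (simp add: darts_def n_def)
        then have "a C = a (face (rep c, 0))" "b C = b (face (rep c, 0))"
          using const[OF a p(1)] const[OF b p(1)] rep(2)[OF c] p(2) by (simp_all add: c_def)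
        moreover have "a (face (rep c, 0)) = b (face (rep c, 0))"
          using fun_cong[OF eq, of "rep c"] c by (auto simp: restrict_def R_def)
        ultimately show ?thesis by simp
      next
        case False
        then show ?thesis using a b by (auto simp: bit_functions_def)
      qed
    qed
    have "restrict ` ?ker \<subseteq> bit_functions R" by (auto simp: restrict_def bit_functions_def)
    from card_inj_on_le[OF inj this card_bit_functions(1)[OF finR]]
    show ?thesis by (simp add: card_bit_functions(2)[OF finR])
  qed

  \<comment> \<open>Modulo boundaries, a crossing equals the chosen one in its component, by a path of edges.\<close>
  have cokernel: "2 ^ n \<le> card (boundary ` bit_functions E) * 2 ^ card R"
  proof -
    define N where "N = boundary ` bit_functions E"
    have N_add: "(\<lambda>c. x c + y c) \<in> N" if "x \<in> N" "y \<in> N" for x y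
    proof -
      obtain z w where "z \<in> bit_functions E" "w \<in> bit_functions E" "x = boundary z" "y = boundary w"
        using \<open>x \<in> N\<close> \<open>y \<in> N\<close> by (auto simp: N_def)
      then show ?thesis
        by (auto simp: N_def boundary_add bit_functions_def intro!: image_eqI[of _ _ "\<lambda>e. z e + w e"])
    qed
    have N_zero: "(\<lambda>c. 0) \<in> N"
      unfolding N_def by (rule image_eqI[of _ _ "\<lambda>e. 0"]) (auto simp: boundary_def bit_functions_def)
    define ind :: "nat \<Rightarrow> nat \<Rightarrow> bit" where "ind = (\<lambda>c c'. of_bool (c' = c))"
    have edge: "(\<lambda>x. ind c x + ind c' x) \<in> N" if "(c, c') \<in> graph_rel" for c c'
    proof -
      obtain p where p: "p \<in> darts D" "c = fst p" "c' = fst (other_end D p)"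
        using \<open>(c, c') \<in> graph_rel\<close> by (auto simp: graph_rel_def)
      have "boundary (ind (label D p)) x = ind c x + ind c' x" for x
      proof -
        have "boundary (ind (label D p)) x = (\<Sum>q\<in>{q \<in> darts D. fst q = x}. if label D q = label D p then 1 else 0)"
          unfolding boundary_def ind_def by (intro sum.cong) auto
        also have "\<dots> = (\<Sum>q\<in>darts D. if fst q = x then if label D q = label D p then 1 else 0 else 0)"
          by (rule sum.inter_filter[OF finite_darts])
        also have "\<dots> = (\<Sum>q\<in>darts D. if label D q = label D p then if fst q = x then 1 else 0 else 0)"
          by (intro sum.cong) auto
        also have "\<dots> = (\<Sum>q\<in>{q \<in> darts D. label D q = label D p}. if fst q = x then 1 else 0)"
          by (rule sum.inter_filter[OF finite_darts, symmetric])
        also have "\<dots> = ind c x + ind c' x"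
          using darts_same_label[OF D p(1)] oe(2)[OF p(1)] p by (auto simp: ind_def)
        finally show ?thesis .
      qed
      then have "boundary (ind (label D p)) = (\<lambda>x. ind c x + ind c' x)" ..
      moreover have "ind (label D p) \<in> bit_functions E" using p(1) by (auto simp: bit_functions_def ind_def E_def)
      ultimately show ?thesis unfolding N_def by (metis image_eqI)
    qed
    have edge': "(\<lambda>x. ind c x + ind c' x) \<in> N" if "(c', c) \<in> graph_rel" for c c'
      using edge[OF that] by (simp add: add.commute)
    have path: "(\<lambda>x. ind c x + ind c' x) \<in> N" if "(c, c') \<in> (graph_rel \<union> graph_rel\<inverse>)\<^sup>*" for c c'
      using that
    proof (induction rule: rtrancl_induct)
      case base
      then show ?case using N_zero by (simp add: bit_add_same)
    next
      case (step c1 c2)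
      have "(\<lambda>x. ind c1 x + ind c2 x) \<in> N"
        using step.hyps(2) edge edge' by blast
      from N_add[OF step.IH this]
      have "(\<lambda>x. ind c x + (ind c1 x + ind c1 x) + ind c2 x) \<in> N" by (simp only: add.assoc)
      then show ?case by (simp add: bit_add_same)
    qed
    define spanned where "spanned = (\<lambda>(x, r). (\<lambda>c. x c + r c)) ` (N \<times> bit_functions R)"
    have spanned_add: "(\<lambda>c. x c + y c) \<in> spanned" if "x \<in> spanned" "y \<in> spanned" for x y
    proof -
      obtain a r b s where "a \<in> N" "r \<in> bit_functions R" "b \<in> N" "s \<in> bit_functions R"
        "x = (\<lambda>c. a c + r c)" "y = (\<lambda>c. b c + s c)"
        using \<open>x \<in> spanned\<close> \<open>y \<in> spanned\<close> by (auto simp: spanned_def)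
      then show ?thesis unfolding spanned_def using N_add
        by (intro image_eqI[of _ _ "(\<lambda>c. a c + b c, \<lambda>c. r c + s c)"])
          (auto simp: bit_functions_def add.assoc add.left_commute)
    qed
    have spanned_ind: "ind c \<in> spanned" if "c < n" for c
    proof -
      have "ind c = (\<lambda>x. (ind c x + ind (rep c) x) + ind (rep c) x)" by (simp add: add.assoc bit_add_same)
      moreover have "ind (rep c) \<in> bit_functions R" using that by (auto simp: ind_def bit_functions_def R_def)
      ultimately show ?thesis unfolding spanned_def using path[OF rep(2)[OF that]]
        by (intro image_eqI[of _ _ "(\<lambda>x. ind c x + ind (rep c) x, ind (rep c))"]) auto
    qed
    have spanned_set: "(\<lambda>c. of_bool (c \<in> X)) \<in> spanned" if "finite X" "X \<subseteq> {..<n}" for X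
      using that
    proof (induction X rule: finite_induct)
      case empty
      have "(\<lambda>c. 0) \<in> bit_functions R" by (simp add: bit_functions_def)
      then show ?case unfolding spanned_def using N_zero
        by (intro image_eqI[of _ _ "(\<lambda>c. 0, \<lambda>c. 0)"]) auto
    next
      case (insert c X)
      have "(\<lambda>x. of_bool (x \<in> insert c X)) = (\<lambda>x. ind c x + of_bool (x \<in> X))"
        using insert.hyps by (auto simp: ind_def)
      then show ?case using spanned_add[OF spanned_ind, of c] insert by simp
    qed
    have "bit_functions {..<n} \<subseteq> spanned"
    proof
      fix b :: "nat \<Rightarrow> bit" assume b: "b \<in> bit_functions {..<n}"
      define X where "X = {c. b c = 1}"
      have "X \<subseteq> {..<n}"
      proof
        fix c assume "c \<in> X"
        then have "b c \<noteq> 0" by (simp add: X_def)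
        then show "c \<in> {..<n}" using b unfolding bit_functions_def by blast
      qed
      moreover have "b = (\<lambda>c. of_bool (c \<in> X))"
      proof
        show "b c = of_bool (c \<in> X)" for c using bit_cases[of "b c"] by (auto simp: X_def)
      qed
      ultimately show "b \<in> spanned" using spanned_set[of X] finite_subset[of X "{..<n}"] by simp
    qed
    moreover have finN: "finite N" using card_bit_functions(1)[OF finE] by (simp add: N_def)
    ultimately have "card (bit_functions {..<n}) \<le> card spanned"
      using card_bit_functions(1)[OF finR] by (intro card_mono) (auto simp: spanned_def)
    also have "\<dots> \<le> card (N \<times> bit_functions R)"
      unfolding spanned_def using finN card_bit_functions(1)[OF finR] by (intro card_image_le) auto
    finally show ?thesis
      using card_bit_functions(2)[OF finR] card_bit_functions(2)[of "{..<n}"]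
      by (simp add: N_def card_cartesian_product)
  qed

  define Z where "Z = {z \<in> bit_functions E. boundary z = (\<lambda>c. 0)}"
  define B where "B = \<delta> ` bit_functions (faces D)"
  have finZ: "finite Z" using card_bit_functions(1)[OF finE] by (simp add: Z_def)
  have "B \<subseteq> Z" using boundary_\<delta> \<delta>_E by (auto simp: B_def Z_def)
  moreover have "card Z \<le> card B"
  proof -
    let ?K = "card (graph_components D)"
    define N where "N = card (boundary ` bit_functions E)"
    have R: "(2::nat) ^ card R \<le> 2 ^ ?K" using cardR by simp
    have 1: "2 ^ card E = card Z * N"
      unfolding N_def Z_def
      by (subst card_bit_functions(2)[OF finE, symmetric], rule card_kernel_image)
        (auto simp: card_bit_functions(1)[OF finE] boundary_add, auto simp: bit_functions_def)
    have "2 ^ card (faces D) = card {a \<in> bit_functions (faces D). \<delta> a = (\<lambda>e. 0)} * card B"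
      unfolding B_def
      by (subst card_bit_functions(2)[OF finF, symmetric], rule card_kernel_image)
        (auto simp: card_bit_functions(1)[OF finF] \<delta>_add, auto simp: bit_functions_def)
    also have "\<dots> \<le> 2 ^ ?K * card B" using kernel R by (intro mult_right_mono) linarith+
    finally have 2: "2 ^ card (faces D) \<le> 2 ^ ?K * card B" .
    have 3: "2 ^ n \<le> N * 2 ^ ?K" using cokernel R unfolding N_def
      by (meson le_trans mult_le_mono2)
    have "card Z * 2 ^ n * 2 ^ ?K \<le> card Z * (N * 2 ^ ?K) * 2 ^ ?K"
      using 3 by (intro mult_right_mono mult_left_mono) auto
    also have "\<dots> = (card Z * N) * (2 ^ ?K * 2 ^ ?K)" by (simp only: mult.assoc)
    also have "\<dots> = 2 ^ (card E + 2 * ?K)" unfolding 1[symmetric] mult_2 power_add ..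
    also have "\<dots> = 2 ^ n * 2 ^ card (faces D)" unfolding euler[symmetric] by (rule power_add)
    also have "\<dots> \<le> 2 ^ n * (2 ^ ?K * card B)" using 2 by (intro mult_left_mono) auto
    finally have "card Z * 2 ^ n * 2 ^ ?K \<le> 2 ^ n * (2 ^ ?K * card B)" .
    then have "(2 ^ n * 2 ^ ?K) * card Z \<le> (2 ^ n * 2 ^ ?K) * card B" by (simp only: mult_ac)
    moreover have "0 < (2::nat) ^ n * 2 ^ ?K" by simp
    ultimately show ?thesis using nat_mult_le_cancel1 by blast
  qed
  ultimately have "B = Z" using finZ by (intro card_seteq)
  moreover have "(\<lambda>e. of_bool (e \<in> E)) \<in> Z"
  proof -
    have "boundary (\<lambda>e. of_bool (e \<in> E)) c = 0" for c
    proof (cases "c < n")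
      case True
      have "boundary (\<lambda>e. of_bool (e \<in> E)) c = (\<Sum>p\<in>{p \<in> darts D. fst p = c}. 1)"
        unfolding boundary_def by (intro sum.cong) (auto simp: E_def)
      also have "\<dots> = 0" unfolding sum_crossing[OF True] by (simp add: bit_add_same)
      finally show ?thesis .
    next
      case False
      then show ?thesis by (simp add: boundary_def no_darts)
    qed
    then show ?thesis by (auto simp: Z_def bit_functions_def)
  qed
  ultimately obtain a where a: "\<delta> a = (\<lambda>e. of_bool (e \<in> E))" by (auto simp: B_def)
  define col where "col = (\<lambda>p. a (face p) = 1)"
  have sep: "a (face (other_end D p)) \<noteq> a (face p)" if "p \<in> darts D" for p
    using \<delta>_label[OF that, of a] fun_cong[OF a, of "label D p"] that
    by (auto simp: E_def bit_add_eq_1_iff)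
  show ?thesis
  proof (intro exI[of _ col] ballI conjI)
    fix p assume p: "p \<in> darts D"
    show oe_col: "col (other_end D p) \<noteq> col p"
      using sep[OF p] bit_cases[of "a (face p)"] bit_cases[of "a (face (other_end D p))"]
      by (auto simp: col_def)
    show "col (rot p) \<noteq> col p" using oe_col by (simp add: col_def face_rot[OF p])
  qed
qed

section \<open>Circles before and after a change of smoothing\<close>

lemma dart_cases:
  assumes "p \<in> darts D"
  obtains c where "c < ncross D" "p = (c, 0) \<or> p = (c, 1) \<or> p = (c, 2) \<or> p = (c, 3)"
proof -
  obtain c k where "p = (c, k)" "c < ncross D" "k < 4" using assms by (auto simp: darts_def)
  moreover then have "k = 0 \<or> k = 1 \<or> k = 2 \<or> k = 3" by linarith
  ultimately show ?thesis using that by blast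
qed

lemma smooth_values:
  "smooth v (c, 0) = (if c \<in> v then (c, 3) else (c, 1))"
  "smooth v (c, 1) = (if c \<in> v then (c, 2) else (c, 0))"
  "smooth v (c, 2) = (if c \<in> v then (c, 1) else (c, 3))"
  "smooth v (c, 3) = (if c \<in> v then (c, 0) else (c, 2))"
  by (simp_all add: smooth_def)

lemma corner_darts:
  "c < ncross D \<Longrightarrow> (c, 0) \<in> darts D" "c < ncross D \<Longrightarrow> (c, 1) \<in> darts D"
  "c < ncross D \<Longrightarrow> (c, 2) \<in> darts D" "c < ncross D \<Longrightarrow> (c, 3) \<in> darts D"
  by (simp_all add: darts_def)

lemma smooth_in_darts: "p \<in> darts D \<Longrightarrow> smooth v p \<in> darts D"
  by (erule dart_cases) (auto simp only: smooth_values corner_darts split: if_splits)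

lemma smooth_smooth: "p \<in> darts D \<Longrightarrow> smooth v (smooth v p) = p"
  by (erule dart_cases) (auto simp only: smooth_values split: if_splits)

lemma fst_smooth: "fst (smooth v p) = fst p"
  by (simp add: smooth_def Let_def split_beta)

lemma smooth_agree: "(fst p \<in> v \<longleftrightarrow> fst p \<in> w) \<Longrightarrow> smooth v p = smooth w p"
  by (simp add: smooth_def split_beta)

lemma smoothing_relI: "p \<in> darts D \<Longrightarrow> (label D p, label D (smooth v p)) \<in> smoothing_rel D v"
  unfolding smoothing_rel_def by blast

lemma smoothing_rel_sym: "sym (smoothing_rel D v)"
proof (rule symI)
  fix e e' assume "(e, e') \<in> smoothing_rel D v"
  then obtain p where "p \<in> darts D" "e = label D p" "e' = label D (smooth v p)"
    by (auto simp: smoothing_rel_def)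
  then show "(e', e) \<in> smoothing_rel D v"
    using smoothing_relI[OF smooth_in_darts[of p D v], of v] smooth_smooth[of p D v] by simp
qed

lemma finite_smoothing_class: "finite ((smoothing_rel D v)\<^sup>* `` {e})"
proof -
  have "finite (smoothing_rel D v)" 
    using finite_darts[of D] unfolding smoothing_rel_def by (rule finite_image_set[of "\<lambda>p. p \<in> darts D", unfolded Collect_mem_eq])
  moreover have "(smoothing_rel D v)\<^sup>* `` {e} \<subseteq> insert e (Range (smoothing_rel D v))"
    by (auto elim: rtranclE)
  ultimately show ?thesis by (meson finite.insertI finite_Range finite_subset)
qed

lemma circle_in_class: "(e, circle D v e) \<in> (smoothing_rel D v)\<^sup>*"
  using Min_in[OF finite_smoothing_class[of D v e]] by (auto simp: circle_def)

lemma circle_eq_iff: "circle D v e = circle D v e' \<longleftrightarrow> (e, e') \<in> (smoothing_rel D v)\<^sup>*"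
proof
  have sym: "sym ((smoothing_rel D v)\<^sup>*)" by (rule sym_rtrancl[OF smoothing_rel_sym])
  show "(e, e') \<in> (smoothing_rel D v)\<^sup>*" if "circle D v e = circle D v e'"
    using circle_in_class[of e D v] circle_in_class[of e' D v] that sym
    by (metis rtrancl_trans symD)
  assume "(e, e') \<in> (smoothing_rel D v)\<^sup>*"
  then have "(smoothing_rel D v)\<^sup>* `` {e} = (smoothing_rel D v)\<^sup>* `` {e'}"
    using sym by (auto dest: symD intro: rtrancl_trans)
  then show "circle D v e = circle D v e'" by (simp add: circle_def)
qed

lemma circle_eq_Min: "circle D v e = Min {e'. circle D v e = circle D v e'}"
  by (subst circle_def) (simp add: circle_eq_iff Image_singleton)

lemma circle_smooth: "p \<in> darts D \<Longrightarrow> circle D v (label D (smooth v p)) = circle D v (label D p)"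
  unfolding circle_eq_iff by (rule symD[OF sym_rtrancl[OF smoothing_rel_sym]]) (blast intro: smoothing_relI)

lemma circle_corners:
  assumes "c < ncross D"
  shows "c \<notin> v \<Longrightarrow> circle D v (label D (c, 0)) = circle D v (label D (c, 1))"
    and "c \<notin> v \<Longrightarrow> circle D v (label D (c, 2)) = circle D v (label D (c, 3))"
    and "c \<in> v \<Longrightarrow> circle D v (label D (c, 0)) = circle D v (label D (c, 3))"
    and "c \<in> v \<Longrightarrow> circle D v (label D (c, 2)) = circle D v (label D (c, 1))"
  using circle_smooth[of "(c, 1)" D v] circle_smooth[of "(c, 3)" D v] corner_darts[OF assms]
  by (simp_all only: smooth_values if_True if_False)

lemma circle_corner:
  assumes "p \<in> darts D" "fst p = c"
  shows "circle D v (label D p) \<in> {circle D v (label D (c, 1)), circle D v (label D (c, 3))}"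
  using assms(2) dart_cases[OF assms(1)] circle_corners[of c D v]
  by (metis (no_types, lifting) fst_conv insertCI)

text \<open>
  The two strands at a crossing lie on one circle of exactly one of the two smoothings. The
  checkerboard colouring orients every circle: it alternates along the walk between leaving and
  entering a crossing, so it suffices to look at the walk on the darts of one colour, which
  permutes them and has the circles as its cycles. Changing the smoothing at \<open>c\<close>
  exchanges the two coloured darts at \<open>c\<close> as destinations of the walk, that is, it
  multiplies this permutation by a transposition.
\<close>

lemma smoothings_differ:
  assumes D: "planar_diagram D" and c: "c < ncross D" "c \<notin> v"
  shows "circle D v (label D (c, 1)) = circle D v (label D (c, 3)) \<longleftrightarrow>
    circle D (insert c v) (label D (c, 1)) \<noteq> circle D (insert c v) (label D (c, 3))"
proof -
  obtain col :: "dart \<Rightarrow> bool"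
    where col: "\<forall>p\<in>darts D. col (other_end D p) \<noteq> col p \<and> col (rot p) \<noteq> col p"
    using checkerboard_colouring[OF D] ..
  have col_oe: "col (other_end D p) \<noteq> col p" and col_rot: "col (rot p) \<noteq> col p" if "p \<in> darts D" for p
    using col that by simp_all
  note oe = other_end[OF D] and oe2 = other_end_other_end[OF D]
  define H where "H = {p \<in> darts D. col p}"
  have finH: "finite H" by (simp add: H_def finite_darts)
  have col_corner: "col (a, 1) \<longleftrightarrow> \<not> col (a, 0)" "col (a, 2) \<longleftrightarrow> col (a, 0)" "col (a, 3) \<longleftrightarrow> \<not> col (a, 0)"
    if "a < ncross D" for a
    using col_rot[OF corner_darts(1)[OF that]] col_rot[OF corner_darts(2)[OF that]]
      col_rot[OF corner_darts(3)[OF that]] unfolding rot_cycle by auto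
  have col_smooth: "col (smooth u p) \<noteq> col p" if "p \<in> darts D" for u p
    using that by (rule dart_cases) (auto simp only: smooth_values col_corner split: if_splits)
  \<comment> \<open>The darts of one colour are those through which crossings are left in the chosen orientation.\<close>
  have walk_H: "walk D u p \<in> H" if "p \<in> H" for u p
    using that col_smooth[of "other_end D p" u] col_oe[of p] oe(1)[of p] smooth_in_darts[of "other_end D p" D u]
    by (auto simp: H_def walk_def)
  have back_H: "other_end D (smooth u p) \<in> H" if "p \<in> H" for u p
    using that col_smooth[of p u] col_oe[of "smooth u p"] oe(1)[of "smooth u p"] smooth_in_darts[of p D u]
    by (simp add: H_def)
  have walk_bij: "bij_betw (walk D u) H H" for u
  proof (rule bij_betw_byWitness[where f' = "\<lambda>p. other_end D (smooth u p)"])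
    show "(\<lambda>p. other_end D (smooth u p)) ` H \<subseteq> H"
      using back_H by blast
    show "walk D u ` H \<subseteq> H" using walk_H by blast
    show "\<forall>p\<in>H. other_end D (smooth u (walk D u p)) = p"
    proof
      fix p assume "p \<in> H"
      then have "p \<in> darts D" by (simp add: H_def)
      then show "other_end D (smooth u (walk D u p)) = p"
        using smooth_smooth[OF oe(1)] oe2 by (simp add: walk_def)
    qed
    show "\<forall>p\<in>H. walk D u (other_end D (smooth u p)) = p"
    proof
      fix p assume "p \<in> H"
      then have "p \<in> darts D" by (simp add: H_def)
      then show "walk D u (other_end D (smooth u p)) = p"
        using oe2[OF smooth_in_darts, of p u] smooth_smooth by (simp add: walk_def)
    qed
  qed
  have inj: "inj_on (label D) H"
  proof (rule inj_onI)
    fix h h' assume "h \<in> H" "h' \<in> H" "label D h = label D h'"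
    then show "h = h'" using other_end_eqI[OF D, of h h'] col_oe[of h] by (auto simp: H_def)
  qed
  have circle_iff: "circle D u (label D h) = circle D u (label D h') \<longleftrightarrow> (h, h') \<in> (graph_on (walk D u) H)\<^sup>*"
    if h: "h \<in> H" "h' \<in> H" for u h h'
  proof
    let ?G = "graph_on (walk D u) H"
    show "circle D u (label D h) = circle D u (label D h')" if "(h, h') \<in> ?G\<^sup>*"
      using that
    proof (induction rule: rtrancl_induct)
      case (step p q)
      then have "q = smooth u (other_end D p)" "p \<in> darts D" by (auto simp: graph_on_def walk_def H_def)
      then show ?case using step.IH circle_smooth[of "other_end D p" D u] oe[of p] by simp
    qed simp
    assume "circle D u (label D h) = circle D u (label D h')"
    then have "(label D h, label D h') \<in> (smoothing_rel D u)\<^sup>*" by (simp add: circle_eq_iff)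
    then have "\<exists>q\<in>H. label D q = label D h' \<and> (h, q) \<in> (?G \<union> ?G\<inverse>)\<^sup>*"
    proof (induction rule: rtrancl_induct)
      case base
      then show ?case using h(1) by blast
    next
      case (step e e')
      then obtain q where q: "q \<in> H" "label D q = e" "(h, q) \<in> (?G \<union> ?G\<inverse>)\<^sup>*" by blast
      obtain p where p: "p \<in> darts D" "e = label D p" "e' = label D (smooth u p)"
        using step.hyps(2) by (auto simp: smoothing_rel_def)
      have "\<exists>q'\<in>H. label D q' = e' \<and> (q, q') \<in> ?G \<union> ?G\<inverse>"
      proof (cases "col p")
        case True
        then have "q = p" using inj_onD[OF inj, of q p] q p by (simp add: H_def)
        let ?q' = "other_end D (smooth u p)"
        have q': "?q' \<in> H" "walk D u ?q' = p" "label D ?q' = e'"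
          using p True col_smooth[OF p(1), of u] col_oe[OF smooth_in_darts[OF p(1), of u]]
            oe[OF smooth_in_darts[OF p(1), of u]] oe2[OF smooth_in_darts[OF p(1), of u]]
          by (auto simp: H_def walk_def smooth_smooth)
        have "(?q', q) \<in> ?G" using graph_onI[OF q'(1), of "walk D u"] q'(2) \<open>q = p\<close> by simp
        then show ?thesis using q' by blast
      next
        case False
        then have "other_end D p \<in> H" using p(1) oe(1) col_oe by (simp add: H_def)
        then have "q = other_end D p"
          using inj_onD[OF inj, of q "other_end D p"] q p oe(3)[OF p(1)] by simp
        then have "walk D u q = smooth u p" using oe2[OF p(1)] by (simp add: walk_def)
        then have "(q, smooth u p) \<in> ?G" "smooth u p \<in> H"
          using graph_onI[OF q(1), of "walk D u"] walk_H[OF q(1), of u] by simp_all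
        then show ?thesis using p(3) by blast
      qed
      then show ?case using q(3) by (meson rtrancl_into_rtrancl)
    qed
    then show "(h, h') \<in> ?G\<^sup>*"
      using inj h(2) rtrancl_graph_on_converse[OF finH walk_bij[of u]] by (metis inj_on_def)
  qed
  define w where "w = insert c v"
  have transposition: "(x, y) \<in> (graph_on (walk D v) H)\<^sup>* \<longleftrightarrow> (x, y) \<notin> (graph_on (walk D w) H)\<^sup>*"
    if xy: "x \<in> H" "x \<noteq> y" "smooth w (smooth v x) = y" "smooth w (smooth v y) = x"
      "\<And>p. p \<in> H \<Longrightarrow> fst p = c \<Longrightarrow> p = x \<or> p = y" "fst x = c" "fst y = c" for x y
  proof (rule same_cycle_transposition[OF finH walk_bij xy(1,2)])
    fix h assume h: "h \<in> H"
    let ?q = "other_end D h"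
    have q: "?q \<in> darts D" using h oe(1) by (simp add: H_def)
    show "walk D w h = (if walk D v h = x then y else if walk D v h = y then x else walk D v h)"
    proof (cases "fst ?q = c")
      case False
      then have "walk D v h \<noteq> x" "walk D v h \<noteq> y" using xy(6,7) fst_smooth[of v ?q] by (auto simp: walk_def)
      then show ?thesis using False smooth_agree[of ?q v w] by (simp add: walk_def w_def)
    next
      case True
      then have "fst (walk D v h) = c" by (simp add: walk_def fst_smooth)
      then have "walk D v h = x \<or> walk D v h = y" using xy(5) walk_H[OF h] by blast
      moreover have "smooth v (walk D v h) = ?q" using q by (simp add: walk_def smooth_smooth)
      ultimately show ?thesis using xy(2-4) by (auto simp: walk_def)
    qed
  qed
  have cw: "c \<in> w" by (simp add: w_def)
  note corners = circle_corners(1,2)[OF c] circle_corners(3,4)[OF c(1) cw]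
  note sv = smooth_values[of v c, unfolded if_not_P[OF c(2)]] smooth_values[of w c, unfolded if_P[OF cw]]
  show ?thesis
  proof (cases "col (c, 1)")
    case True
    have H: "(c, 1) \<in> H" "(c, 3) \<in> H" using True c(1) col_corner[OF c(1)] corner_darts[OF c(1)] by (auto simp: H_def)
    have "p = (c, 1) \<or> p = (c, 3)" if "p \<in> H" "fst p = c" for p
      using that dart_cases[of p D] True col_corner[OF c(1)] by (metis (no_types, lifting) H_def fst_conv mem_Collect_eq)
    then have "((c, 1), (c, 3)) \<in> (graph_on (walk D v) H)\<^sup>* \<longleftrightarrow> ((c, 1), (c, 3)) \<notin> (graph_on (walk D w) H)\<^sup>*"
      by (intro transposition) (simp_all only: H sv fst_conv prod.inject, simp_all)
    then show ?thesis unfolding w_def[symmetric] circle_iff[OF H] .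
  next
    case False
    have H: "(c, 0) \<in> H" "(c, 2) \<in> H" using False c(1) col_corner[OF c(1)] corner_darts[OF c(1)] by (auto simp: H_def)
    have "p = (c, 0) \<or> p = (c, 2)" if "p \<in> H" "fst p = c" for p
      using that dart_cases[of p D] False col_corner[OF c(1)] by (metis (no_types, lifting) H_def fst_conv mem_Collect_eq)
    then have "((c, 0), (c, 2)) \<in> (graph_on (walk D v) H)\<^sup>* \<longleftrightarrow> ((c, 0), (c, 2)) \<notin> (graph_on (walk D w) H)\<^sup>*"
      by (intro transposition) (simp_all only: H sv fst_conv prod.inject, simp_all)
    then have "circle D v (label D (c, 0)) = circle D v (label D (c, 2)) \<longleftrightarrow>
        circle D w (label D (c, 0)) \<noteq> circle D w (label D (c, 2))"
      unfolding circle_iff[OF H] .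
    then show ?thesis
      unfolding w_def[symmetric] corners
        eq_commute[of "circle D w (label D (c, 3))" "circle D w (label D (c, 1))"] .
  qed
qed

text \<open>
  Two partitions of edge labels into circles are given by functions \<open>K\<close> and
  \<open>K'\<close> naming the circle of a label; the second partition arises from the first by
  uniting the two circles of \<open>p\<close> and \<open>q\<close>. A split is treated as a
  merge read backwards.
\<close>

definition joins :: "'e \<Rightarrow> 'e \<Rightarrow> ('e \<Rightarrow> 'k) \<Rightarrow> ('e \<Rightarrow> 'k) \<Rightarrow> bool"
  where "joins p q K K' \<longleftrightarrow> K p \<noteq> K q \<and>
    (\<forall>e e'. K' e = K' e' \<longleftrightarrow> K e = K e' \<or> {K e, K e'} = {K p, K q})"

lemma joins_commute: "joins p q K K' \<longleftrightarrow> joins q p K K'"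
  by (auto simp: joins_def insert_commute)

lemma joins_ends: "joins p q K K' \<Longrightarrow> K' p = K' q"
  by (auto simp: joins_def)

lemma joins_mono: "joins p q K K' \<Longrightarrow> K e = K e' \<Longrightarrow> K' e = K' e'"
  by (auto simp: joins_def)

lemma joins_cases: "joins p q K K' \<Longrightarrow> K' e = K' e' \<Longrightarrow> K e \<noteq> K e' \<Longrightarrow> {K e, K e'} = {K p, K q}"
  by (auto simp: joins_def)

lemma card_joins:
  assumes j: "joins p q K K'" and E: "finite E" "p \<in> E" "q \<in> E"
  shows "card (K ` E) = card (K' ` E) + 1"
proof -
  \<comment> \<open>The map of circles induced by passing to the coarser partition.\<close>
  define g where "g = (\<lambda>b. K' (SOME e. K e = b))"
  have g: "K' e = g (K e)" for e
    unfolding g_def using someI[of "\<lambda>e'. K e' = K e" e] by (intro joins_mono[OF j]) simp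
  have "bij_betw g (K ` E - {K q}) (K' ` E)"
    unfolding bij_betw_def
  proof
    show "inj_on g (K ` E - {K q})"
    proof (rule inj_onI)
      fix a b assume "a \<in> K ` E - {K q}" "b \<in> K ` E - {K q}" and gab: "g a = g b"
      then obtain e e' where e: "a = K e" "b = K e'" "K e \<noteq> K q" "K e' \<noteq> K q" by blast
      then have "K' e = K' e'" using gab g by simp
      from joins_cases[OF j this] show "a = b" using e by (auto simp: doubleton_eq_iff)
    qed
    show "g ` (K ` E - {K q}) = K' ` E"
    proof
      show "g ` (K ` E - {K q}) \<subseteq> K' ` E" using g by auto
      have "K' e \<in> g ` (K ` E - {K q})" if "e \<in> E" for e
      proof (cases "K e = K q")
        case True
        then have "K' e = g (K p)" using joins_mono[OF j True] joins_ends[OF j] g[of p] by simp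
        moreover have "K p \<noteq> K q" using j by (simp add: joins_def)
        ultimately show ?thesis using E(2) by blast
      next
        case False
        then show ?thesis using g[of e] that by blast
      qed
      then show "K' ` E \<subseteq> g ` (K ` E - {K q})" by blast
    qed
  qed
  then have "card (K ` E - {K q}) = card (K' ` E)" by (rule bij_betw_same_card)
  then show ?thesis using E card_Suc_Diff1[of "K ` E" "K q"] by simp
qed

text \<open>
  Away from \<open>c\<close> both smoothings connect the same strands, and at \<open>c\<close>
  each of them connects every strand end to end 1 or to end 3.
\<close>

lemma circle_joinsI:
  assumes c: "c < ncross D" and vw: "insert c v = insert c w"
    and v: "circle D v (label D (c, 1)) \<noteq> circle D v (label D (c, 3))"
    and w: "circle D w (label D (c, 1)) = circle D w (label D (c, 3))"
  shows "joins (label D (c, 1)) (label D (c, 3)) (circle D v) (circle D w)"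
proof -
  define p q where "p = label D (c, 1)" and "q = label D (c, 3)"
  have agree: "smooth v d = smooth w d" if "fst d \<noteq> c" for d
    using vw that by (intro smooth_agree) blast
  have corner: "circle D u (label D d) \<in> {circle D u p, circle D u q}"
    if "d \<in> darts D" "fst d = c" for u d
    using circle_corner[OF that] by (simp add: p_def q_def)
  have mono: "circle D w e = circle D w e'" if "circle D v e = circle D v e'" for e e'
    using that unfolding circle_eq_iff[of D v]
  proof (induction rule: rtrancl_induct)
    case (step e1 e2)
    then obtain d where d: "d \<in> darts D" "e1 = label D d" "e2 = label D (smooth v d)"
      unfolding smoothing_rel_def by blast
    have "circle D w e1 = circle D w e2"
    proof (cases "fst d = c")
      case True
      have "fst (smooth v d) = c" using True by (simp add: fst_smooth)
      from corner[OF d(1) True, of w] corner[OF smooth_in_darts[OF d(1)] this, of w]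
      show ?thesis using w d by (simp add: p_def q_def)
    next
      case False
      then show ?thesis using circle_smooth[OF d(1), of w] agree[of d] d by simp
    qed
    then show ?case using step.IH by simp
  qed simp
  have only_if: "circle D v e = circle D v e' \<or> {circle D v e, circle D v e'} = {circle D v p, circle D v q}"
    if "circle D w e = circle D w e'" for e e'
    using that unfolding circle_eq_iff[of D w]
  proof (induction rule: rtrancl_induct)
    case (step e1 e2)
    then obtain d where d: "d \<in> darts D" "e1 = label D d" "e2 = label D (smooth w d)"
      unfolding smoothing_rel_def by blast
    show ?case
    proof (cases "fst d = c")
      case True
      have "fst (smooth w d) = c" using True by (simp add: fst_smooth)
      from corner[OF d(1) True, of v] corner[OF smooth_in_darts[OF d(1)] this, of v]
      have "circle D v e1 \<in> {circle D v p, circle D v q}" "circle D v e2 \<in> {circle D v p, circle D v q}"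
        unfolding d by this+
      then show ?thesis using step.IH by (auto simp: doubleton_eq_iff)
    next
      case False
      then show ?thesis using circle_smooth[OF d(1), of v] agree[of d] d step.IH by simp
    qed
  qed simp
  have "circle D w e = circle D w e'"
    if eq: "{circle D v e, circle D v e'} = {circle D v p, circle D v q}" for e e'
  proof -
    have "circle D w x = circle D w p" if "circle D v x \<in> {circle D v p, circle D v q}" for x
      using that mono[of x p] mono[of x q] w by (auto simp: p_def q_def)
    moreover have "circle D v e \<in> {circle D v p, circle D v q}" "circle D v e' \<in> {circle D v p, circle D v q}"
      using eq by blast+
    ultimately show ?thesis by metis
  qed
  with only_if mono v show ?thesis
    unfolding joins_def p_def[symmetric] q_def[symmetric] by (intro conjI allI iffI) (assumption | erule disjE | blast)+
qed

definition merges :: "diagram \<Rightarrow> nat set \<Rightarrow> nat \<Rightarrow> bool"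
  where "merges D v c \<longleftrightarrow> circle D v (label D (c, 0)) \<noteq> circle D v (label D (c, 2))"

lemma merges_joins:
  assumes D: "planar_diagram D" and c: "c < ncross D" "c \<notin> v"
  shows "merges D v c \<Longrightarrow>
      joins (label D (c, 1)) (label D (c, 3)) (circle D v) (circle D (insert c v))"
    and "\<not> merges D v c \<Longrightarrow>
      joins (label D (c, 1)) (label D (c, 3)) (circle D (insert c v)) (circle D v)"
proof -
  note merges = merges_def[of D v c, unfolded circle_corners(1,2)[OF c]]
  show "merges D v c \<Longrightarrow>
      joins (label D (c, 1)) (label D (c, 3)) (circle D v) (circle D (insert c v))"
    using smoothings_differ[OF D c] unfolding merges by (intro circle_joinsI[OF c(1)]) simp_all
  show "\<not> merges D v c \<Longrightarrow>
      joins (label D (c, 1)) (label D (c, 3)) (circle D (insert c v)) (circle D v)"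
    using smoothings_differ[OF D c] unfolding merges by (intro circle_joinsI[OF c(1)]) simp_all
qed

text \<open>
  A circle is named by the minimum of its labels, so it keeps its name as long as it keeps its
  labels.
\<close>

lemma circle_unchanged:
  assumes "joins p q (circle D v) (circle D w) \<or> joins p q (circle D w) (circle D v)"
    and "circle D v e \<notin> {circle D v p, circle D v q}"
  shows "circle D w e = circle D v e"
proof -
  have iff: "circle D w e = circle D w e' \<longleftrightarrow> circle D v e = circle D v e'" for e'
    using assms(1)
  proof
    assume j: "joins p q (circle D v) (circle D w)"
    then show ?thesis using joins_mono[OF j, of e e'] joins_cases[OF j, of e e'] assms(2) by blast
  next
    assume j: "joins p q (circle D w) (circle D v)"
    have "circle D w e \<notin> {circle D w p, circle D w q}"
      using joins_mono[OF j, of e p] joins_mono[OF j, of e q] assms(2) by blast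
    then show ?thesis using joins_mono[OF j, of e e'] joins_cases[OF j, of e e'] by blast
  qed
  have "circle D w e = Min {e'. circle D w e = circle D w e'}" by (rule circle_eq_Min)
  also have "\<dots> = Min {e'. circle D v e = circle D v e'}" unfolding iff ..
  also have "\<dots> = circle D v e" by (rule circle_eq_Min[symmetric])
  finally show ?thesis .
qed

lemma finite_edges: "planar_diagram D \<Longrightarrow> finite (edges D)"
  by (simp add: edges_def planar_diagram_def finite_darts)

lemma finite_circles: "planar_diagram D \<Longrightarrow> finite (circles D v)"
  by (simp add: circles_def finite_edges)

lemma label_edges: "p \<in> darts D \<Longrightarrow> label D p \<in> edges D"
  by (simp add: edges_def)

section \<open>Edge maps on words of edge labels\<close>

text \<open>
  Products of circles indexed by labels of edges through which they pass. Such a product has a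
  meaning at every vertex of the cube, which allows one to compare elements of different
  algebras without choosing lifts.
\<close>

definition edge_word :: "diagram \<Rightarrow> nat set \<Rightarrow> nat list \<Rightarrow> valg"
  where "edge_word D v es = word (map (circle D v) es)"

abbreviation "linear_edge_map D arc v c \<equiv> extend_linearly (circles D v) (edge_map D arc v c)"

text \<open>
  Only the two merging circles are renamed, and both receive the name of their union.
\<close>

lemma edge_map_merge:
  assumes D: "planar_diagram D" and c: "c < ncross D" "c \<notin> v" and m: "merges D v c"
    and es: "set es \<subseteq> edges D"
  shows "linear_edge_map D arc v c (edge_word D v es) = edge_word D (insert c v) es"
proof -
  define w where "w = insert c v"
  define f where "f = (\<lambda>b. if b = circle D v (label D (c, 0)) \<or> b = circle D v (label D (c, 2))
    then circle D w (label D (c, 0)) else b)"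
  have j: "joins (label D (c, 1)) (label D (c, 3)) (circle D v) (circle D w)"
    unfolding w_def by (rule merges_joins(1)[OF D c m])
  note corners = circle_corners(1,2)[OF c]
  have f: "f (circle D v e) = circle D w e" for e
  proof (cases "circle D v e \<in> {circle D v (label D (c, 1)), circle D v (label D (c, 3))}")
    case True
    then have "circle D w e = circle D w (label D (c, 1))"
      using joins_mono[OF j, of e "label D (c, 1)"] joins_mono[OF j, of e "label D (c, 3)"]
        joins_ends[OF j] by (metis insertE singletonD)
    moreover have "circle D w (label D (c, 0)) = circle D w (label D (c, 1))"
      using joins_mono[OF j corners(1)] .
    ultimately show ?thesis using True unfolding f_def corners by (metis insertE singletonD)
  next
    case False
    then have "circle D w e = circle D v e" using circle_unchanged j by blast
    then show ?thesis using False unfolding f_def corners by (metis insertCI)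
  qed
  have "edge_map D arc v c = (\<lambda>S. alg_map f S)"
    using m unfolding edge_map_def merges_def f_def w_def Let_def by simp
  moreover have "extend_linearly (circles D v) (\<lambda>S. alg_map f S) (edge_word D v es) =
      word (map f (map (circle D v) es))"
    unfolding edge_word_def using es finite_circles[OF D, of v]
    by (intro extend_linearly_word[where \<Phi> = "\<lambda>x. x"]) (auto simp: circles_def)
  ultimately show ?thesis by (simp add: edge_word_def f comp_def w_def)
qed

text \<open>
  A split is multiplication by \<open>b\<^sub>1 + \<xi> b\<^sub>2\<close> after lifting every
  circle to one that is contained in it; by the interchangeability of \<open>b\<^sub>1\<close>
  and \<open>b\<^sub>2\<close>, each factor may be lifted to the circle through its own label.
\<close>

lemma edge_map_split:
  assumes D: "planar_diagram D" and c: "c < ncross D" "c \<notin> v" and m: "\<not> merges D v c"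
    and es: "set es \<subseteq> edges D"
  shows "linear_edge_map D arc v c (edge_word D v es) =
    split_mult (circle D (insert c v) (label D (c, if arc c then 1 else 3)))
      (circle D (insert c v) (label D (c, if arc c then 3 else 1))) (edge_word D (insert c v) es)"
proof -
  define w where "w = insert c v"
  define b1 where "b1 = circle D w (label D (c, if arc c then 1 else 3))"
  define b2 where "b2 = circle D w (label D (c, if arc c then 3 else 1))"
  define a where "a = circle D v (label D (c, 0))"
  define f where "f = (\<lambda>b. if b = a then b1 else b)"
  have j: "joins (label D (c, 1)) (label D (c, 3)) (circle D w) (circle D v)"
    unfolding w_def by (rule merges_joins(2)[OF D c m])
  have b: "{b1, b2} = {circle D w (label D (c, 1)), circle D w (label D (c, 3))}"
    by (auto simp: b1_def b2_def)
  have a: "circle D v (label D (c, 1)) = a" "circle D v (label D (c, 3)) = a"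
    using joins_ends[OF j] circle_corners(1)[OF c] by (simp_all only: a_def)
  have f: "f (circle D v e) = circle D w e \<or> {f (circle D v e), circle D w e} \<subseteq> {b1, b2}" for e
  proof (cases "circle D v e = a")
    case True
    then have "circle D v e = circle D v (label D (c, 1))" using a by (simp only:)
    then have "circle D w e \<in> {b1, b2}"
      using joins_cases[OF j, of e "label D (c, 1)"] unfolding b by blast
    then show ?thesis using True by (simp add: f_def)
  next
    case False
    then have "circle D v e \<notin> {circle D v (label D (c, 1)), circle D v (label D (c, 3))}"
      unfolding a by blast
    then have "circle D w e = circle D v e" using circle_unchanged j by blast
    then show ?thesis using False by (simp add: f_def)
  qed
  have E: "edge_map D arc v c = (\<lambda>S. split_mult b1 b2 (alg_map f S))"
  proof
    fix S
    have "edge_map D arc v c S = vmult (\<lambda>T. monomial {b1} T + xi * monomial {b2} T) (alg_map f S)"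
      using m unfolding edge_map_def merges_def f_def a_def b1_def b2_def w_def Let_def by simp
    also have "\<dots> = split_mult b1 b2 (alg_map f S)"
      by (rule vmult_split) (simp add: alg_map_def word_infinite)
    finally show "edge_map D arc v c S = split_mult b1 b2 (alg_map f S)" .
  qed
  have "linear_edge_map D arc v c (edge_word D v es) =
      split_mult b1 b2 (word (map f (map (circle D v) es)))"
    unfolding edge_word_def E using es finite_circles[OF D, of v]
    by (intro extend_linearly_word split_mult_scale) (auto simp: circles_def)
  also have "\<dots> = split_mult b1 b2 (word (map (circle D w) es))"
    unfolding map_map using f by (intro split_mult_word_cong) simp
  finally show ?thesis by (simp add: edge_word_def b1_def b2_def w_def)
qed

text \<open>
  A label on the circle at the tail of the arc rotated by 90 degrees, which is the circle
  \<open>a\<^sub>1\<close> of the split map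
  \<open>x \<mapsto> (a\<^sub>1 + \<xi> a\<^sub>2) x\<close>; \<open>rotated_head\<close> gives
  \<open>a\<^sub>2\<close>.
\<close>

definition rotated_tail :: "diagram \<Rightarrow> (nat \<Rightarrow> bool) \<Rightarrow> nat \<Rightarrow> nat"
  where "rotated_tail D arc c = label D (c, if arc c then 1 else 3)"

definition rotated_head :: "diagram \<Rightarrow> (nat \<Rightarrow> bool) \<Rightarrow> nat \<Rightarrow> nat"
  where "rotated_head D arc c = label D (c, if arc c then 3 else 1)"

abbreviation "split_at D arc c w \<equiv>
  split_mult (circle D w (rotated_tail D arc c)) (circle D w (rotated_head D arc c))"

lemma split_at_edge_word:
  "split_at D arc c w (edge_word D w es) = (\<lambda>U. edge_word D w (rotated_tail D arc c # es) U +
    xi * edge_word D w (rotated_head D arc c # es) U)"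
  by (simp add: split_mult_def edge_word_def word_Cons)

lemma rotated_edges:
  assumes "c < ncross D" shows "rotated_tail D arc c \<in> edges D" "rotated_head D arc c \<in> edges D"
  using corner_darts[OF assms] by (simp_all add: rotated_tail_def rotated_head_def label_edges)

lemma rotated_joins:
  assumes D: "planar_diagram D" and c: "c < ncross D" "c \<notin> v"
  shows "merges D v c \<Longrightarrow>
      joins (rotated_tail D arc c) (rotated_head D arc c) (circle D v) (circle D (insert c v))"
    and "\<not> merges D v c \<Longrightarrow>
      joins (rotated_tail D arc c) (rotated_head D arc c) (circle D (insert c v)) (circle D v)"
proof -
  have "joins (label D (c, 1)) (label D (c, 3)) K K' \<Longrightarrow>
      joins (rotated_tail D arc c) (rotated_head D arc c) K K'" for K K' :: "nat \<Rightarrow> nat"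
    unfolding rotated_tail_def rotated_head_def
    using joins_commute[of "label D (c, 1)" "label D (c, 3)" K K'] by (cases "arc c") (simp_all only: if_True if_False)
  with merges_joins[OF assms] show "merges D v c \<Longrightarrow>
      joins (rotated_tail D arc c) (rotated_head D arc c) (circle D v) (circle D (insert c v))"
    and "\<not> merges D v c \<Longrightarrow>
      joins (rotated_tail D arc c) (rotated_head D arc c) (circle D (insert c v)) (circle D v)"
    by blast+
qed

lemma linear_edge_map_word:
  assumes D: "planar_diagram D" and c: "c < ncross D" "c \<notin> v" and es: "set es \<subseteq> edges D"
  shows "linear_edge_map D arc v c (edge_word D v es) =
    (if merges D v c then edge_word D (insert c v) es
     else split_at D arc c (insert c v) (edge_word D (insert c v) es))"
  using edge_map_merge[OF D c _ es] edge_map_split[OF D c _ es]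
  by (simp add: rotated_tail_def rotated_head_def)

text \<open>
  A factor \<open>p + \<xi> q\<close> produced by an earlier split is itself a combination of
  words, so the next edge map carries it along.
\<close>

lemma linear_edge_map_split_at:
  assumes D: "planar_diagram D" and c: "c < ncross D" "c \<notin> v" and c': "c' < ncross D"
    and es: "set es \<subseteq> edges D"
  shows "linear_edge_map D arc v c (split_at D arc c' v (edge_word D v es)) =
    (if merges D v c then split_at D arc c' (insert c v) (edge_word D (insert c v) es)
     else split_at D arc c (insert c v) (split_at D arc c' (insert c v) (edge_word D (insert c v) es)))"
proof -
  let ?p = "rotated_tail D arc c'" and ?q = "rotated_head D arc c'"
  have "set (?p # es) \<subseteq> edges D" "set (?q # es) \<subseteq> edges D" using es rotated_edges[OF c'] by auto
  note words = this[THEN linear_edge_map_word[OF D c, where arc = arc]]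
  have "linear_edge_map D arc v c (split_at D arc c' v (edge_word D v es)) =
      (\<lambda>U. linear_edge_map D arc v c (edge_word D v (?p # es)) U +
        xi * linear_edge_map D arc v c (edge_word D v (?q # es)) U)"
    by (simp only: split_at_edge_word extend_linearly_add extend_linearly_scale)
  moreover have "split_at D arc c (insert c v) (split_at D arc c' (insert c v) (edge_word D (insert c v) es)) =
      (\<lambda>U. split_at D arc c (insert c v) (edge_word D (insert c v) (?p # es)) U +
        xi * split_at D arc c (insert c v) (edge_word D (insert c v) (?q # es)) U)"
    by (simp only: split_at_edge_word[where c = c'] split_mult_add split_mult_scale)
  ultimately show ?thesis
    by (simp only: words split_at_edge_word[where c = c'] if_True if_False split: if_split) simp
qed

lemma card_circles_insert:
  assumes D: "planar_diagram D" and c: "c < ncross D" "c \<notin> v"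
  shows "int (card (circles D (insert c v))) = int (card (circles D v)) + (if merges D v c then -1 else 1)"
  using card_joins[OF rotated_joins(1)[OF D c] finite_edges[OF D] rotated_edges[OF c(1)]]
    card_joins[OF rotated_joins(2)[OF D c] finite_edges[OF D] rotated_edges[OF c(1)]]
  by (simp add: circles_def)

section \<open>The 2-faces of the cube\<close>

text \<open>
  On words of edge labels merges do nothing and splits multiply from the left by the factor of
  their crossing, evaluated at the last vertex \<open>w\<close>. Counting circles shows that
  both paths contain the same number of splits. If there are two, the factors appear in opposite
  orders, and interchanging them costs a factor \<open>\<xi>\<close>. If there is none, or one
  that belongs to the same crossing on both paths, the composites agree. Otherwise each path
  splits at a different crossing, and then the two factors involve the same circles. Either they
  consist of the same pair of circles, possibly in opposite order, or they are both
  \<open>(1 + \<xi>) a\<close> for one and the same circle \<open>a\<close>.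
\<close>

lemma face_words:
  assumes D: "planar_diagram D" and c: "c < ncross D" "c \<notin> v" and c': "c' < ncross D" "c' \<notin> v" and "c \<noteq> c'"
  shows "\<exists>\<epsilon>\<in>{1, xi}. \<forall>es. set es \<subseteq> edges D \<longrightarrow>
    linear_edge_map D arc (insert c v) c' (linear_edge_map D arc v c (edge_word D v es)) =
    (\<lambda>U. \<epsilon> * linear_edge_map D arc (insert c' v) c (linear_edge_map D arc v c' (edge_word D v es)) U)"
proof -
  define w where "w = insert c' (insert c v)"
  have w': "insert c (insert c' v) = w" by (auto simp: w_def)
  have nc': "c' \<notin> insert c v" and nc: "c \<notin> insert c' v" using assms by auto
  define m where "m = merges D v c"
  define n where "n = merges D (insert c v) c'"
  define m' where "m' = merges D v c'"
  define n' where "n' = merges D (insert c' v) c"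
  define S where "S = split_at D arc c w"
  define S' where "S' = split_at D arc c' w"
  define K where "K = circle D w"
  define p where "p = rotated_tail D arc c"
  define q where "q = rotated_head D arc c"
  define p' where "p' = rotated_tail D arc c'"
  define q' where "q' = rotated_head D arc c'"
  note joins_c = rotated_joins[OF D c, of arc, folded m_def p_def q_def]
    and joins_c' = rotated_joins[OF D c', of arc, folded m'_def p'_def q'_def]
    and joins_cc' = rotated_joins[OF D c'(1) nc', of arc, folded n_def p'_def q'_def w_def K_def]
    and joins_c'c = rotated_joins[OF D c(1) nc, of arc, unfolded w', folded n'_def p_def q_def K_def]
  have f: "linear_edge_map D arc (insert c v) c' (linear_edge_map D arc v c (edge_word D v es)) =
      (if m then if n then edge_word D w es else S' (edge_word D w es)
       else if n then S (edge_word D w es) else S' (S (edge_word D w es)))"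
    if "set es \<subseteq> edges D" for es
    using linear_edge_map_word[OF D c that, of arc] linear_edge_map_word[OF D c'(1) nc' that, of arc]
      linear_edge_map_split_at[OF D c'(1) nc' c(1) that, of arc]
    by (simp add: m_def n_def S_def S'_def w_def)
  have g: "linear_edge_map D arc (insert c' v) c (linear_edge_map D arc v c' (edge_word D v es)) =
      (if m' then if n' then edge_word D w es else S (edge_word D w es)
       else if n' then S' (edge_word D w es) else S (S' (edge_word D w es)))"
    if "set es \<subseteq> edges D" for es
    using linear_edge_map_word[OF D c' that, of arc] linear_edge_map_word[OF D c(1) nc that, of arc]
      linear_edge_map_split_at[OF D c(1) nc c'(1) that, of arc]
    by (simp add: m'_def n'_def S_def S'_def w')
  have S: "S = split_mult (K p) (K q)" and S': "S' = split_mult (K p') (K q')"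
    by (simp_all add: S_def S'_def K_def p_def q_def p'_def q'_def)
  have count: "(if m then -1 else 1) + (if n then -1 else 1) = (if m' then -1 else 1) + (if n' then -1 else (1::int))"
    using card_circles_insert[OF D c] card_circles_insert[OF D c'(1) nc']
      card_circles_insert[OF D c'] card_circles_insert[OF D c(1) nc]
    unfolding w' w_def[symmetric] m_def m'_def n_def n'_def by linarith
  \<comment> \<open>A merge lowers the number of circles by one and a split raises it; this excludes all other cases.\<close>
  consider "m" "n" "m'" "n'" | "\<not> m" "\<not> n" "\<not> m'" "\<not> n'" | "m" "\<not> n" "m'" "\<not> n'"
    | "\<not> m" "n" "\<not> m'" "n'" | "m \<noteq> n" "m' \<noteq> n'" "m \<noteq> m'"
    using count by (cases m; cases n; cases m'; cases n') simp_all
  then show ?thesis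
  proof cases
    case 1
    then show ?thesis by (intro bexI[of _ 1]) (simp_all add: f g)
  next
    case 2
    then show ?thesis
      by (intro bexI[of _ xi]) (simp_all add: f g S S' split_mult_commute[of "K p'" "K q'" "K p" "K q"])
  next
    case 3
    have "K p' \<noteq> K q'" using joins_cc'(2)[OF 3(2)] by (simp add: joins_def)
    moreover have "circle D (insert c' v) p' = circle D (insert c' v) q'"
      using joins_ends[OF joins_c'(1)[OF 3(3)]] .
    ultimately have "{K p', K q'} = {K p, K q}" using joins_cases[OF joins_c'c(2)[OF 3(4)]] by blast
    then consider "K p' = K p" "K q' = K q" | "K p' = K q" "K q' = K p" by (auto simp: doubleton_eq_iff)
    then show ?thesis
    proof cases
      case 1
      then show ?thesis using 3 by (intro bexI[of _ 1]) (simp_all add: f g S S')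
    next
      case 2
      then show ?thesis using 3
        by (intro bexI[of _ xi]) (simp_all add: f g S S' split_mult_swap[of "K q" "K p"])
    qed
  next
    case 4
    have j: "joins p' q' (circle D (insert c v)) K" using joins_cc'(1)[OF 4(2)] .
    have Kpq: "K p = K q" using joins_ends[OF joins_c'c(1)[OF 4(4)]] .
    have Kpq': "K p' = K q'" using joins_ends[OF j] .
    have "circle D (insert c v) p \<noteq> circle D (insert c v) q"
      using joins_c(2)[OF 4(1)] by (simp add: joins_def)
    then have "{circle D (insert c v) p, circle D (insert c v) q} =
        {circle D (insert c v) p', circle D (insert c v) q'}"
      using joins_cases[OF j Kpq] by blast
    then have "circle D (insert c v) p = circle D (insert c v) p' \<or> circle D (insert c v) p = circle D (insert c v) q'"
      by (auto simp: doubleton_eq_iff)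
    then have "K p = K p'" using joins_mono[OF j] Kpq' by metis
    then show ?thesis using 4 Kpq Kpq' by (intro bexI[of _ 1]) (simp_all add: f g S S')
  next
    case 5
    then show ?thesis by (intro bexI[of _ 1]) (simp_all add: f g)
  qed
qed

lemma smoothing_class_edges:
  assumes "(e, e') \<in> (smoothing_rel D v)\<^sup>*" "e \<in> edges D" shows "e' \<in> edges D"
  using assms by (induction rule: rtrancl_induct) (auto simp: smoothing_rel_def smooth_in_darts label_edges)

lemma circles_fixed:
  assumes "b \<in> circles D v" shows "b \<in> edges D" "circle D v b = b"
proof -
  obtain e where e: "e \<in> edges D" "b = circle D v e" using assms by (auto simp: circles_def)
  then have "(e, b) \<in> (smoothing_rel D v)\<^sup>*" using circle_in_class by simp
  then show "b \<in> edges D" "circle D v b = b"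
    using smoothing_class_edges e circle_eq_iff[of D v e b] by simp_all
qed

lemma monomial_edge_word:
  assumes D: "planar_diagram D" and S: "S \<subseteq> circles D v"
  shows "monomial S = edge_word D v (sorted_list_of_set S)" "set (sorted_list_of_set S) \<subseteq> edges D"
proof -
  have fin: "finite S" using S finite_circles[OF D] finite_subset by blast
  have "map (circle D v) (sorted_list_of_set S) = sorted_list_of_set S"
    using S fin circles_fixed(2) by (intro map_idI) auto
  then show "monomial S = edge_word D v (sorted_list_of_set S)"
    using fin by (simp add: edge_word_def word_sorted_list_of_set)
  show "set (sorted_list_of_set S) \<subseteq> edges D" using S fin circles_fixed(1) by auto
qed

lemma edge_map_eq_linear:
  assumes D: "planar_diagram D" and S: "S \<subseteq> circles D v"
  shows "edge_map D arc v c S = linear_edge_map D arc v c (edge_word D v (sorted_list_of_set S))"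
  using extend_linearly_monomial[OF finite_circles[OF D] S, of "edge_map D arc v c"]
  by (simp add: monomial_edge_word(1)[OF D S])

lemma edge_word_support:
  assumes "set es \<subseteq> edges D" "edge_word D v es T \<noteq> 0" shows "T \<subseteq> circles D v"
  using word_support[of "map (circle D v) es" T] assms by (auto simp: edge_word_def circles_def)

lemma edge_map_support:
  assumes D: "planar_diagram D" and c: "c < ncross D" "c \<notin> v" and S: "S \<subseteq> circles D v"
    and nz: "edge_map D arc v c S T \<noteq> 0"
  shows "T \<subseteq> circles D (insert c v)"
proof -
  define es where "es = sorted_list_of_set S"
  note es = monomial_edge_word(2)[OF D S, folded es_def]
  note ends = rotated_edges[OF c(1), of arc]
  have "edge_map D arc v c S = (if merges D v c then edge_word D (insert c v) es
     else split_at D arc c (insert c v) (edge_word D (insert c v) es))"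
    unfolding edge_map_eq_linear[OF D S] es_def[symmetric] by (rule linear_edge_map_word[OF D c es])
  then have "edge_word D (insert c v) es T \<noteq> 0 \<or> edge_word D (insert c v) (rotated_tail D arc c # es) T \<noteq> 0
      \<or> edge_word D (insert c v) (rotated_head D arc c # es) T \<noteq> 0"
    using nz by (auto simp: split_at_edge_word split: if_splits)
  then show ?thesis
    using edge_word_support[OF es] edge_word_support[of "rotated_tail D arc c # es"]
      edge_word_support[of "rotated_head D arc c # es"] es ends by fastforce
qed

definition composite :: "diagram \<Rightarrow> (nat \<Rightarrow> bool) \<Rightarrow> nat set \<Rightarrow> nat \<Rightarrow> nat \<Rightarrow> nat set \<Rightarrow> valg"
  where "composite D arc v c c' S = linear_edge_map D arc (insert c v) c' (edge_map D arc v c S)"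

lemma face_commutes:
  assumes D: "planar_diagram D" and c: "c < ncross D" "c \<notin> v" and c': "c' < ncross D" "c' \<notin> v" and "c \<noteq> c'"
  shows "\<exists>\<epsilon>\<in>{1, xi}. \<forall>S U. S \<subseteq> circles D v \<longrightarrow> composite D arc v c c' S U = \<epsilon> * composite D arc v c' c S U"
proof -
  obtain \<epsilon> where \<epsilon>: "\<epsilon> \<in> {1, xi}" and words: "\<forall>es. set es \<subseteq> edges D \<longrightarrow>
    linear_edge_map D arc (insert c v) c' (linear_edge_map D arc v c (edge_word D v es)) =
    (\<lambda>U. \<epsilon> * linear_edge_map D arc (insert c' v) c (linear_edge_map D arc v c' (edge_word D v es)) U)"
    using face_words[OF assms, of arc] by (rule bexE)
  show ?thesis
  proof (intro bexI[OF _ \<epsilon>] allI impI)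
    fix S U assume S: "S \<subseteq> circles D v"
    from fun_cong[OF words[rule_format, OF monomial_edge_word(2)[OF D S]], of U]
    show "composite D arc v c c' S U = \<epsilon> * composite D arc v c' c S U"
      by (simp add: composite_def edge_map_eq_linear[OF D S])
  qed
qed

section \<open>Units and signs\<close>

lemma to_o_sum: "to_o (sum f A) = (\<Sum>a\<in>A. to_o (f a))"
  by (induction A rule: infinite_finite_induct) (simp_all add: to_o_hom)

lemma odd_composite_eq:
  "odd_composite D arc v c c' S U = (if S \<subseteq> circles D v then to_o (composite D arc v c c' S U) else 0)"
  by (simp add: odd_composite_def composite_def extend_linearly_def to_o_sum to_o_hom)

lemma prod_signs:
  assumes "finite X" "\<And>e. e \<in> X \<Longrightarrow> f e = 1 \<or> f e = (-1 :: int)"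
  shows "prod f X = (-1) ^ card {e \<in> X. f e = -1}"
  using assms
proof (induction X rule: finite_induct)
  case (insert x X)
  have "f x = 1 \<or> f x = -1" using insert.prems by simp
  then show ?case
  proof
    assume "f x = 1"
    then have "{e \<in> insert x X. f e = -1} = {e \<in> X. f e = -1}" by auto
    then show ?thesis using insert \<open>f x = 1\<close> by simp
  next
    assume "f x = -1"
    then have "{e \<in> insert x X. f e = -1} = insert x {e \<in> X. f e = -1}" by auto
    then show ?thesis using insert \<open>f x = -1\<close> by simp
  qed
qed simp

text \<open>
  It suffices to compare in the even and in the odd theory. In the even one the composites
  agree, and the odd number of units \<open>-1\<close> makes the products of the units along the
  two paths opposite. In the odd one the composites agree or are opposite; unless they vanish,
  the products of the units are then opposite or equal respectively.
\<close>

lemma face_cancels: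
  assumes D: "planar_diagram D" and u: "unit_choice D arc u" and v: "v \<subseteq> {..<ncross D}"
    and c: "c < ncross D" "c \<notin> v" and c': "c' < ncross D" "c' \<notin> v" and ne: "c \<noteq> c'"
    and S: "S \<subseteq> circles D v"
  shows "u (v, c) * u (insert c v, c') * composite D arc v c c' S U +
    u (v, c') * u (insert c' v, c) * composite D arc v c' c S U = 0"
proof -
  define A where "A = u (v, c) * u (insert c v, c')"
  define B where "B = u (v, c') * u (insert c' v, c)"
  define X where "X = composite D arc v c c'"
  define Y where "Y = composite D arc v c' c"
  obtain \<epsilon> where \<epsilon>: "\<epsilon> = 1 \<or> \<epsilon> = xi" and XY: "\<And>S U. S \<subseteq> circles D v \<Longrightarrow> X S U = \<epsilon> * Y S U"
    using face_commutes[OF D c c' ne, of arc] unfolding X_def Y_def by blast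
  have unit: "u (v', a) \<in> {1, -1, xi, -xi}" if "v' \<subseteq> {..<ncross D}" "a < ncross D" "a \<notin> v'" for v' a
    by (rule mp[OF u[unfolded unit_choice_def, THEN conjunct1, THEN spec[of _ v'], THEN spec[of _ a]]])
      (intro conjI that)
  have units: "u e \<in> {1, -1, xi, -xi}" if "e \<in> face_edges v c c'" for e
  proof -
    have "insert c v \<subseteq> {..<ncross D}" "insert c' v \<subseteq> {..<ncross D}" using v c c' by auto
    then have "u (v, c) \<in> {1, -1, xi, -xi} \<and> u (insert c v, c') \<in> {1, -1, xi, -xi} \<and>
        u (v, c') \<in> {1, -1, xi, -xi} \<and> u (insert c' v, c) \<in> {1, -1, xi, -xi}"
      using v c c' ne by (intro conjI unit) simp_all
    moreover have "e = (v, c) \<or> e = (insert c v, c') \<or> e = (v, c') \<or> e = (insert c' v, c)"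
      using that by (simp add: face_edges_def)
    ultimately show ?thesis by metis
  qed
  have fin: "finite (face_edges v c c')" by (simp add: face_edges_def)
  have prod_face: "prod f (face_edges v c c') = (f (v, c) * f (insert c v, c')) * (f (v, c') * f (insert c' v, c))"
    for f :: "nat set \<times> nat \<Rightarrow> int"
  proof -
    have "insert c v \<noteq> v" "insert c' v \<noteq> v" "insert c v \<noteq> insert c' v" using c c' ne by blast+
    then show ?thesis using ne by (simp add: face_edges_def mult.assoc)
  qed
  define n_e where "n_e = card {e \<in> face_edges v c c'. to_e (u e) = -1}"
  define n_o where "n_o = card {e \<in> face_edges v c c'. to_o (u e) = -1}"
  have "(\<Prod>e\<in>face_edges v c c'. to_e (u e)) = (-1) ^ n_e"
    unfolding n_e_def
  proof (rule prod_signs[OF fin])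
    fix e assume "e \<in> face_edges v c c'"
    from units[OF this] show "to_e (u e) = 1 \<or> to_e (u e) = -1" by (auto simp: to_e_hom)
  qed
  then have AB_e: "to_e A * to_e B = (-1) ^ n_e" by (simp add: prod_face A_def B_def to_e_hom)
  have "(\<Prod>e\<in>face_edges v c c'. to_o (u e)) = (-1) ^ n_o"
    unfolding n_o_def
  proof (rule prod_signs[OF fin])
    fix e assume "e \<in> face_edges v c c'"
    from units[OF this] show "to_o (u e) = 1 \<or> to_o (u e) = -1" by (auto simp: to_o_hom)
  qed
  then have AB_o: "to_o A * to_o B = (-1) ^ n_o" by (simp add: prod_face A_def B_def to_o_hom)
  have signs: "a = b * s" if "a * b = s" "s = 1 \<or> s = -1" for a b s :: int
    using that zmult_eq_1_iff[of a b] zmult_eq_1_iff[of "-a" b] by auto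
  define f where "f = odd_composite D arc v c c'"
  define g where "g = odd_composite D arc v c' c"
  have "v \<subseteq> {..<ncross D} \<and> c < ncross D \<and> c' < ncross D \<and> c \<notin> v \<and> c' \<notin> v \<and> c \<noteq> c'"
    by (intro conjI v c c' ne)
  note choices = mp[OF u[unfolded unit_choice_def, THEN conjunct2, THEN spec[of _ v],
    THEN spec[of _ c], THEN spec[of _ c']] this, unfolded Let_def, folded f_def g_def n_e_def n_o_def]
  note choice = choices[THEN conjunct1] choices[THEN conjunct2, THEN conjunct1]
    choices[THEN conjunct2, THEN conjunct2, THEN conjunct1]
  have "A * X S U + B * Y S U = 0"
  proof (rule zxi_eqI)
    have "to_e (X S U) = to_e (Y S U)" using XY[OF S, of U] \<epsilon> by (auto simp: to_e_hom)
    moreover have "to_e A = - to_e B" using signs[OF AB_e] choice(1) by simp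
    ultimately show "to_e (A * X S U + B * Y S U) = to_e 0" by (simp add: to_e_hom)
    have fS: "f S U = to_o (X S U)" and gS: "g S U = to_o (Y S U)"
      using S by (simp_all add: f_def g_def odd_composite_eq X_def Y_def)
    from \<epsilon> have "to_o A * f S U + to_o B * g S U = 0"
    proof
      assume "\<epsilon> = 1"
      then have fg: "f = g"
        using XY by (intro ext) (simp add: f_def g_def odd_composite_eq flip: X_def Y_def)
      show ?thesis
      proof (cases "f = (\<lambda>S U. 0)")
        case False
        then have "to_o A = - to_o B" using signs[OF AB_o] choice(2) fg False by simp
        then show ?thesis using fg by simp
      qed (use fg in simp)
    next
      assume "\<epsilon> = xi"
      then have fg: "f = (\<lambda>S U. - g S U)"
        using XY by (intro ext) (simp add: f_def g_def odd_composite_eq to_o_hom flip: X_def Y_def)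
      show ?thesis
      proof (cases "g = (\<lambda>S U. 0)")
        case False
        then have "f \<noteq> (\<lambda>S U. 0)" using fg by (auto simp: fun_eq_iff)
        then have "to_o A = to_o B" using signs[OF AB_o] choice(3) fg False by simp
        then show ?thesis using fg by simp
      qed (use fg in simp)
    qed
    then show "to_o (A * X S U + B * Y S U) = to_o 0" using fS gS by (simp add: to_o_hom)
  qed
  then show ?thesis by (simp add: A_def B_def X_def Y_def)
qed

section \<open>Cohomology classes and connecting homomorphisms\<close>

definition is_differential :: "diagram \<Rightarrow> ((gen \<Rightarrow> 'r::comm_ring_1) \<Rightarrow> gen \<Rightarrow> 'r) \<Rightarrow> bool"
  where "is_differential D d \<longleftrightarrow>
    (\<forall>x y. d (\<lambda>g. x g + y g) = (\<lambda>g. d x g + d y g)) \<and>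
    (\<forall>i. \<forall>x\<in>cochains D i. d x \<in> cochains D (i + 1) \<and> d (d x) = (\<lambda>g. 0))"

lemma differential_add: "is_differential D d \<Longrightarrow> d (\<lambda>g. x g + y g) = (\<lambda>g. d x g + d y g)"
  by (simp add: is_differential_def)

lemma differential_cochains: "is_differential D d \<Longrightarrow> x \<in> cochains D i \<Longrightarrow> d x \<in> cochains D (i + 1)"
  by (simp add: is_differential_def)

lemma differential_square: "is_differential D d \<Longrightarrow> x \<in> cochains D i \<Longrightarrow> d (d x) = (\<lambda>g. 0)"
  by (simp add: is_differential_def)

lemma differential_zero: assumes "is_differential D d" shows "d (\<lambda>g. 0) = (\<lambda>g. 0)"
proof
  fix g
  have "d (\<lambda>g. 0 + 0) g = d (\<lambda>g. 0) g + d (\<lambda>g. 0) g"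
    by (subst differential_add[OF assms]) simp
  then show "d (\<lambda>g. 0) g = 0" by simp
qed

lemma differential_diff:
  assumes "is_differential D d" shows "d (\<lambda>g. x g - y g) = (\<lambda>g. d x g - d y g)"
proof
  fix g
  have "d (\<lambda>g. (x g - y g) + y g) g = d (\<lambda>g. x g - y g) g + d y g"
    by (subst differential_add[OF assms]) simp
  then show "d (\<lambda>g. x g - y g) g = d x g - d y g" by simp
qed

lemma cochains_add: "x \<in> cochains D i \<Longrightarrow> y \<in> cochains D i \<Longrightarrow> (\<lambda>g. x g + y g) \<in> cochains D i"
  and cochains_diff: "x \<in> cochains D i \<Longrightarrow> y \<in> cochains D i \<Longrightarrow> (\<lambda>g. x g - y g) \<in> cochains D i"
  and cochains_zero: "(\<lambda>g. 0) \<in> cochains D i"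
  and cochains_comp: "f 0 = 0 \<Longrightarrow> x \<in> cochains D i \<Longrightarrow> f \<circ> x \<in> cochains D i"
  by (auto simp: cochains_def)

lemma additive_zero_diff:
  fixes f :: "'r::comm_ring_1 \<Rightarrow> 's::comm_ring_1"
  assumes "\<And>a b. f (a + b) = f a + f b"
  shows "f 0 = 0" and "f (a - b) = f a - f b"
proof -
  show "f 0 = 0" using assms[of 0 0] by simp
  show "f (a - b) = f a - f b" using assms[of "a - b" b] by simp
qed

definition cohomology_class ::
    "diagram \<Rightarrow> ((gen \<Rightarrow> 'r::comm_ring_1) \<Rightarrow> gen \<Rightarrow> 'r) \<Rightarrow> int \<Rightarrow> (gen \<Rightarrow> 'r) \<Rightarrow> (gen \<Rightarrow> 'r) set"
  where "cohomology_class D d i x = {\<lambda>g. x g + d w g | w. w \<in> cochains D (i - 1)}"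

lemma carrier_cohomology:
  "carrier (cohomology D d i) = cohomology_class D d i ` {x \<in> cochains D i. d x = (\<lambda>g. 0)}"
proof -
  have *: "d ` cochains D (i - 1) #>\<^bsub>cocycle_group D d i\<^esub> x = cohomology_class D d i x" for x
    by (auto simp: r_coset_def cocycle_group_def cohomology_class_def add.commute)
  show ?thesis
    unfolding cohomology_def FactGroup_def RCOSETS_def
    by (simp add: *) (auto simp: cocycle_group_def)
qed

lemma cohomology_class_self: "is_differential D d \<Longrightarrow> x \<in> cohomology_class D d i x"
  unfolding cohomology_class_def
  by (auto intro!: exI[of _ "\<lambda>g. 0"] simp: differential_zero cochains_zero)

lemma cohomology_class_eqI:
  assumes d: "is_differential D d" and w: "w \<in> cochains D (i - 1)"
    and xy: "\<And>g. x g - y g = d w g"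
  shows "cohomology_class D d i x = cohomology_class D d i y"
proof -
  have "\<exists>w'. (\<lambda>g. x g + d v g) = (\<lambda>g. y g + d w' g) \<and> w' \<in> cochains D (i - 1)"
    if "v \<in> cochains D (i - 1)" for v
    using that w xy by (intro exI[of _ "\<lambda>g. w g + v g"])
      (auto simp: differential_add[OF d] cochains_add fun_eq_iff algebra_simps)
  moreover have "\<exists>w'. (\<lambda>g. y g + d v g) = (\<lambda>g. x g + d w' g) \<and> w' \<in> cochains D (i - 1)"
    if "v \<in> cochains D (i - 1)" for v
    using that w xy by (intro exI[of _ "\<lambda>g. v g - w g"])
      (auto simp: differential_diff[OF d] cochains_diff fun_eq_iff algebra_simps)
  ultimately show ?thesis unfolding cohomology_class_def by blast
qed

lemma cohomology_class_eq:
  assumes "is_differential D d" "y \<in> cohomology_class D d i x"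
  shows "cohomology_class D d i x = cohomology_class D d i y"
proof -
  obtain w where "w \<in> cochains D (i - 1)" "y = (\<lambda>g. x g + d w g)"
    using assms(2) by (auto simp: cohomology_class_def)
  then show ?thesis
    using cohomology_class_eqI[OF assms(1), of w i y x] by simp
qed

text \<open>
  Cohomology classes are cosets of the coboundaries, and the image of a coboundary is a
  coboundary. So the image class is unique and the definite description in
  \<open>induced\<close> denotes it.
\<close>

lemma induced_cohomology_class:
  fixes f :: "'r::comm_ring_1 \<Rightarrow> 's::comm_ring_1"
  assumes d: "is_differential D d" and d': "is_differential D d'"
    and add: "\<And>a b. f (a + b) = f a + f b" and comm: "\<And>x. f \<circ> d x = d' (f \<circ> x)"
    and x: "x \<in> cochains D i" "d x = (\<lambda>g. 0)"
  shows "induced D f d' i (cohomology_class D d i x) = cohomology_class D d' i (f \<circ> x)"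
  unfolding induced_def
proof (rule the_equality)
  note f0 = additive_zero_diff(1)[of f, OF add]
  have "d' (f \<circ> x) = (\<lambda>g. 0)" using comm[of x] x(2) f0 by (auto simp: fun_eq_iff)
  then have "cohomology_class D d' i (f \<circ> x) \<in> carrier (cohomology D d' i)"
    using x(1) f0 by (auto simp: carrier_cohomology cochains_comp)
  then show "cohomology_class D d' i (f \<circ> x) \<in> carrier (cohomology D d' i) \<and>
      (\<exists>z\<in>cohomology_class D d i x. f \<circ> z \<in> cohomology_class D d' i (f \<circ> x))"
    using cohomology_class_self[OF d] cohomology_class_self[OF d'] by blast
  fix b assume b: "b \<in> carrier (cohomology D d' i) \<and> (\<exists>z\<in>cohomology_class D d i x. f \<circ> z \<in> b)"
  then obtain y z where y: "b = cohomology_class D d' i y" and z: "z \<in> cohomology_class D d i x" "f \<circ> z \<in> b"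
    by (auto simp: carrier_cohomology)
  from z(1) obtain w where w: "w \<in> cochains D (i - 1)" "z = (\<lambda>g. x g + d w g)"
    by (auto simp: cohomology_class_def)
  have "b = cohomology_class D d' i (f \<circ> z)"
    using cohomology_class_eq[OF d'] y z(2) by simp
  also have "\<dots> = cohomology_class D d' i (f \<circ> x)"
  proof (rule cohomology_class_eqI[OF d'])
    show "f \<circ> w \<in> cochains D (i - 1)" using w(1) f0 by (rule cochains_comp[rotated])
    show "(f \<circ> z) g - (f \<circ> x) g = d' (f \<circ> w) g" for g
      using fun_cong[OF comm[of w], of g] w(2) by (simp add: add)
  qed
  finally show "b = cohomology_class D d' i (f \<circ> x)" .
qed

text \<open>
  The usual diagram chase for the independence of choices. If \<open>x'\<close> is another lift
  of a representative, then \<open>x' - x\<close> differs from the coboundary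
  \<open>d w'\<close> of a lift by a cochain that dies under \<open>p\<close>, hence by some
  \<open>f \<circ> s\<close>. Applying \<open>d\<close> removes \<open>d w'\<close>, and
  \<open>y' - y = d' s\<close>.
\<close>

lemma connecting_cohomology_class:
  fixes f :: "'r::comm_ring_1 \<Rightarrow> 's::comm_ring_1" and p :: "'s \<Rightarrow> 't::comm_ring_1"
  assumes d': "is_differential D d'" and d: "is_differential D d" and d'': "is_differential D d''"
    and f_add: "\<And>a b. f (a + b) = f a + f b" and p_add: "\<And>a b. p (a + b) = p a + p b"
    and f_inj: "inj f" and p_surj: "surj p" and exact: "\<And>z. p z = 0 \<Longrightarrow> z \<in> range f"
    and f_comm: "\<And>y. f \<circ> d' y = d (f \<circ> y)" and p_comm: "\<And>x. p \<circ> d x = d'' (p \<circ> x)"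
    and x: "x \<in> cochains D i" and y: "y \<in> cochains D (i + 1)" and xy: "d x = f \<circ> y"
  shows "connecting D f p d' d i (cohomology_class D d'' i (p \<circ> x)) = cohomology_class D d' (i + 1) y"
  unfolding connecting_def
proof (rule the_equality)
  note f0 = additive_zero_diff(1)[of f, OF f_add] and p0 = additive_zero_diff(1)[of p, OF p_add]
  note f_diff = additive_zero_diff(2)[of f, OF f_add] and p_diff = additive_zero_diff(2)[of p, OF p_add]
  have "f \<circ> d' y = (\<lambda>g. 0)" using f_comm[of y] xy differential_square[OF d x] by simp
  then have "f (d' y g) = f 0" for g by (metis comp_apply f0)
  then have "d' y = (\<lambda>g. 0)" using f_inj by (auto simp: inj_def)
  then have "cohomology_class D d' (i + 1) y \<in> carrier (cohomology D d' (i + 1))"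
    using y by (auto simp: carrier_cohomology)
  then show "cohomology_class D d' (i + 1) y \<in> carrier (cohomology D d' (i + 1)) \<and>
      (\<exists>x'\<in>cochains D i. \<exists>y'\<in>cohomology_class D d' (i + 1) y.
        p \<circ> x' \<in> cohomology_class D d'' i (p \<circ> x) \<and> d x' = f \<circ> y')"
    using cohomology_class_self[OF d'] cohomology_class_self[OF d''] x xy by blast
  fix b assume "b \<in> carrier (cohomology D d' (i + 1)) \<and>
      (\<exists>x'\<in>cochains D i. \<exists>y'\<in>b. p \<circ> x' \<in> cohomology_class D d'' i (p \<circ> x) \<and> d x' = f \<circ> y')"
  then obtain z x' y' where z: "b = cohomology_class D d' (i + 1) z" and x': "x' \<in> cochains D i"
    and y': "y' \<in> b" "d x' = f \<circ> y'" and "p \<circ> x' \<in> cohomology_class D d'' i (p \<circ> x)"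
    by (auto simp: carrier_cohomology)
  then obtain w where w: "w \<in> cochains D (i - 1)" "p \<circ> x' = (\<lambda>g. (p \<circ> x) g + d'' w g)"
    by (auto simp: cohomology_class_def)
  \<comment> \<open>The lift has to vanish where \<open>w\<close> does in order to be a cochain.\<close>
  define w' where "w' = (\<lambda>g. if w g = 0 then 0 else inv_into UNIV p (w g))"
  have w': "w' \<in> cochains D (i - 1)" "p \<circ> w' = w"
    using w(1) p_surj p0 by (auto simp: w'_def cochains_def fun_eq_iff surj_f_inv_f)
  define k where "k = (\<lambda>g. (x' g - x g) - d w' g)"
  have k: "k \<in> cochains D i"
    unfolding k_def using x x' differential_cochains[OF d w'(1)] by (auto intro!: cochains_diff)
  have "p (k g) = 0" for g
    using fun_cong[OF w(2), of g] fun_cong[OF p_comm[of w'], of g] w'(2) by (simp add: k_def p_diff)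
  then have fk: "f (inv_into UNIV f (k g)) = k g" for g using exact by (simp add: f_inv_into_f)
  define s where "s = (\<lambda>g. inv_into UNIV f (k g))"
  have "inv_into UNIV f 0 = 0" using f0 f_inj by (metis inv_f_f)
  then have s: "s \<in> cochains D i" "f \<circ> s = k"
    using k fk by (auto simp: s_def cochains_def fun_eq_iff)
  have "cohomology_class D d' (i + 1) y' = cohomology_class D d' (i + 1) y"
  proof (rule cohomology_class_eqI[OF d'])
    show "s \<in> cochains D (i + 1 - 1)" using s by simp
    fix g
    have "f (d' s g) = d k g" using fun_cong[OF f_comm[of s], of g] s(2) by simp
    also have "d k = (\<lambda>g. (d x' g - d x g) - d (d w') g)"
      by (simp add: k_def differential_diff[OF d])
    also have "\<dots> g = f (y' g - y g)"
      using y'(2) xy differential_square[OF d w'(1)] by (simp add: f_diff)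
    finally show "y' g - y g = d' s g" using f_inj by (simp add: inj_eq)
  qed
  then show "b = cohomology_class D d' (i + 1) y"
    using cohomology_class_eq[OF d'] z y'(1) by simp
qed

section \<open>The differential squares to zero\<close>

lemma zxi_double_eq_0: "z + z = 0 \<Longrightarrow> z = (0 :: zxi)"
proof (rule zxi_eqI)
  assume "z + z = 0"
  have "to_e z + to_e z = 0" using arg_cong[OF \<open>z + z = 0\<close>, of to_e] by (simp only: to_e_hom)
  then show "to_e z = to_e 0" by (simp add: to_e_hom)
  have "to_o z + to_o z = 0" using arg_cong[OF \<open>z + z = 0\<close>, of to_o] by (simp only: to_o_hom)
  then show "to_o z = to_o 0" by (simp add: to_o_hom)
qed

definition all_gens :: "diagram \<Rightarrow> gen set"
  where "all_gens D = Sigma (Pow {..<ncross D}) (\<lambda>v. Pow (circles D v))"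

lemma differential_eq:
  assumes "planar_diagram D"
  shows "differential h D arc u x g' = (\<Sum>g\<in>all_gens D. h (d_matrix D arc u g g') * x g)"
  unfolding differential_def all_gens_def
  by (subst sum.Sigma) (auto simp: finite_circles[OF assms] intro!: sum.cong)

text \<open>
  The matrix entry is a sum over ordered pairs of crossings whose smoothings are changed one
  after the other, and the contributions of the two orders cancel. So the sum and the sum with
  the two crossings exchanged, which is the same, add up to zero, and the ring has no 2-torsion.
\<close>

lemma d_matrix_square:
  assumes D: "planar_diagram D" and u: "unit_choice D arc u" and g: "g \<in> all_gens D"
  shows "(\<Sum>g'\<in>all_gens D. d_matrix D arc u g g' * d_matrix D arc u g' g'') = 0"
proof -
  obtain v S where gS: "g = (v, S)" and v: "v \<subseteq> {..<ncross D}" and S: "S \<subseteq> circles D v"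
    using g by (auto simp: all_gens_def)
  obtain w U where g'': "g'' = (w, U)" by (cases g'')
  define N where "N = {..<ncross D} - v"
  \<comment> \<open>The contribution of first changing the smoothing at \<open>c\<close> and then the one at \<open>c'\<close>.\<close>
  define F where "F = (\<lambda>c c'. if c' \<noteq> c \<and> w = insert c' (insert c v)
    then u (v, c) * u (insert c v, c') * composite D arc v c c' S U else 0)"
  define Y where "Y = (\<lambda>v' T. d_matrix D arc u (v', T) (w, U))"
  have finN: "finite N" by (simp add: N_def)
  have inner: "(\<Sum>T\<in>Pow (circles D (insert c v)). u (v, c) * edge_map D arc v c S T * Y (insert c v) T) =
      (\<Sum>c'\<in>N. F c c')" if "c \<in> N" for c
  proof -
    have "Y (insert c v) T = (\<Sum>c'\<in>N. if c' \<noteq> c \<and> w = insert c' (insert c v)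
        then u (insert c v, c') * edge_map D arc (insert c v) c' T U else 0)" for T
    proof -
      have "{..<ncross D} - insert c v = N - {c}" by (auto simp: N_def)
      then have "Y (insert c v) T = (\<Sum>c'\<in>N - {c}. if w = insert c' (insert c v)
          then u (insert c v, c') * edge_map D arc (insert c v) c' T U else 0)"
        by (simp add: Y_def d_matrix_def)
      also have "\<dots> = (\<Sum>c'\<in>N. if c' \<noteq> c \<and> w = insert c' (insert c v)
          then u (insert c v, c') * edge_map D arc (insert c v) c' T U else 0)"
        using finN by (intro sum.mono_neutral_cong_left) auto
      finally show ?thesis .
    qed
    then have "(\<Sum>T\<in>Pow (circles D (insert c v)). u (v, c) * edge_map D arc v c S T * Y (insert c v) T) =
        (\<Sum>T\<in>Pow (circles D (insert c v)). \<Sum>c'\<in>N. if c' \<noteq> c \<and> w = insert c' (insert c v)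
          then u (v, c) * edge_map D arc v c S T * (u (insert c v, c') * edge_map D arc (insert c v) c' T U) else 0)"
      by (auto simp: sum_distrib_left intro!: sum.cong)
    also have "\<dots> = (\<Sum>c'\<in>N. \<Sum>T\<in>Pow (circles D (insert c v)). if c' \<noteq> c \<and> w = insert c' (insert c v)
          then u (v, c) * edge_map D arc v c S T * (u (insert c v, c') * edge_map D arc (insert c v) c' T U) else 0)"
      by (rule sum.swap)
    also have "\<dots> = (\<Sum>c'\<in>N. F c c')"
      by (intro sum.cong) (auto simp: F_def composite_def extend_linearly_def sum_distrib_left mult_ac)
    finally show ?thesis .
  qed
  have "(\<Sum>g'\<in>all_gens D. d_matrix D arc u g g' * d_matrix D arc u g' g'') =
      (\<Sum>v'\<in>Pow {..<ncross D}. \<Sum>T\<in>Pow (circles D v').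
        (\<Sum>c\<in>N. if v' = insert c v then u (v, c) * edge_map D arc v c S T else 0) * Y v' T)"
    unfolding all_gens_def gS g'' Y_def
    by (subst sum.Sigma) (auto simp: finite_circles[OF D] d_matrix_def N_def intro!: sum.cong)
  also have "\<dots> = (\<Sum>v'\<in>Pow {..<ncross D}. \<Sum>T\<in>Pow (circles D v'). \<Sum>c\<in>N.
      if v' = insert c v then u (v, c) * edge_map D arc v c S T * Y v' T else 0)"
    by (auto simp: sum_distrib_right intro!: sum.cong)
  also have "\<dots> = (\<Sum>v'\<in>Pow {..<ncross D}. \<Sum>c\<in>N. \<Sum>T\<in>Pow (circles D v').
      if v' = insert c v then u (v, c) * edge_map D arc v c S T * Y v' T else 0)"
    by (intro sum.cong refl sum.swap)
  also have "\<dots> = (\<Sum>c\<in>N. \<Sum>v'\<in>Pow {..<ncross D}. \<Sum>T\<in>Pow (circles D v').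
      if v' = insert c v then u (v, c) * edge_map D arc v c S T * Y v' T else 0)"
    by (rule sum.swap)
  also have "\<dots> = (\<Sum>c\<in>N. \<Sum>v'\<in>Pow {..<ncross D}. if v' = insert c v then
      (\<Sum>T\<in>Pow (circles D (insert c v)). u (v, c) * edge_map D arc v c S T * Y (insert c v) T) else 0)"
    by (intro sum.cong refl) auto
  also have "\<dots> = (\<Sum>c\<in>N. \<Sum>T\<in>Pow (circles D (insert c v)). u (v, c) * edge_map D arc v c S T * Y (insert c v) T)"
  proof (rule sum.cong[OF refl])
    fix c assume "c \<in> N"
    then have "insert c v \<in> Pow {..<ncross D}" using v by (auto simp: N_def)
    then show "(\<Sum>v'\<in>Pow {..<ncross D}. if v' = insert c v then
        (\<Sum>T\<in>Pow (circles D (insert c v)). u (v, c) * edge_map D arc v c S T * Y (insert c v) T) else 0) =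
      (\<Sum>T\<in>Pow (circles D (insert c v)). u (v, c) * edge_map D arc v c S T * Y (insert c v) T)"
      by (subst sum.delta) simp_all
  qed
  also have "\<dots> = (\<Sum>c\<in>N. \<Sum>c'\<in>N. F c c')" by (intro sum.cong refl inner)
  also have "\<dots> = 0"
  proof (rule zxi_double_eq_0)
    have cancel: "F c c' + F c' c = 0" if "c \<in> N" "c' \<in> N" for c c'
    proof (cases "c' \<noteq> c \<and> w = insert c' (insert c v)")
      case True
      then have "F c c' + F c' c = u (v, c) * u (insert c v, c') * composite D arc v c c' S U +
          u (v, c') * u (insert c' v, c) * composite D arc v c' c S U"
        by (auto simp: F_def insert_commute)
      also have "\<dots> = 0" using that True by (intro face_cancels[OF D u v _ _ _ _ _ S]) (auto simp: N_def)
      finally show ?thesis .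
    next
      case False
      then show ?thesis by (auto simp: F_def insert_commute)
    qed
    have "(\<Sum>c\<in>N. \<Sum>c'\<in>N. F c c') + (\<Sum>c\<in>N. \<Sum>c'\<in>N. F c c') =
        (\<Sum>c\<in>N. \<Sum>c'\<in>N. F c c') + (\<Sum>c\<in>N. \<Sum>c'\<in>N. F c' c)"
      by (subst (2) sum.swap) (rule refl)
    also have "\<dots> = (\<Sum>c\<in>N. \<Sum>c'\<in>N. F c c' + F c' c)" by (simp add: sum.distrib)
    also have "\<dots> = 0" by (simp add: cancel)
    finally show "(\<Sum>c\<in>N. \<Sum>c'\<in>N. F c c') + (\<Sum>c\<in>N. \<Sum>c'\<in>N. F c c') = 0" .
  qed
  finally show ?thesis .
qed

lemma d_matrix_degree:
  assumes D: "planar_diagram D" and g: "g \<in> gens D i" and nz: "d_matrix D arc u g g' \<noteq> 0"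
  shows "g' \<in> gens D (i + 1)"
proof -
  obtain v S where gS: "g = (v, S)" and v: "v \<subseteq> {..<ncross D}" "int (card v) = i + int (n_minus D)"
    and S: "S \<subseteq> circles D v"
    using g by (auto simp: gens_def)
  obtain w T where g': "g' = (w, T)" by (cases g')
  obtain c where c: "c \<in> {..<ncross D} - v" and
    "(if w = insert c v then u (v, c) * edge_map D arc v c S T else 0) \<noteq> 0"
    using nz unfolding gS g' d_matrix_def by (auto elim: sum.not_neutral_contains_not_neutral)
  then have w: "w = insert c v" and "edge_map D arc v c S T \<noteq> 0" by (auto split: if_splits)
  then have "T \<subseteq> circles D w" using edge_map_support[OF D _ _ S] c by auto
  moreover have "finite v" using v(1) finite_subset by blast
  ultimately show ?thesis using c v by (auto simp: g' w gens_def)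
qed

text \<open>
  Compatibility with \<open>0\<close>, sums and products is what carries the relation
  \<open>d\<^sub>\<xi>\<^sup>2 = 0\<close> over to a change of coefficients.
\<close>

definition ring_map :: "(zxi \<Rightarrow> 'r::comm_ring_1) \<Rightarrow> bool"
  where "ring_map h \<longleftrightarrow> h 0 = 0 \<and> (\<forall>x y. h (x + y) = h x + h y \<and> h (x * y) = h x * h y)"

lemma ring_map_sum: "ring_map h \<Longrightarrow> h (sum f A) = (\<Sum>a\<in>A. h (f a))"
  by (induction A rule: infinite_finite_induct) (simp_all add: ring_map_def)

lemma is_differential_differential:
  assumes D: "planar_diagram D" and u: "unit_choice D arc u" and h: "ring_map h"
  shows "is_differential D (differential h D arc u)"
  unfolding is_differential_def
proof (intro conjI allI ballI)
  let ?d = "differential h D arc u"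
  show "?d (\<lambda>g. x g + y g) = (\<lambda>g. ?d x g + ?d y g)" for x y
    by (simp add: fun_eq_iff differential_eq[OF D] distrib_left sum.distrib)
  fix i and x :: "gen \<Rightarrow> 'a" assume x: "x \<in> cochains D i"
  show "?d x \<in> cochains D (i + 1)"
    unfolding cochains_def
  proof (intro CollectI allI impI)
    fix g' assume g': "g' \<notin> gens D (i + 1)"
    have "h (d_matrix D arc u g g') * x g = 0" for g
    proof (cases "g \<in> gens D i")
      case True
      then have "d_matrix D arc u g g' = 0" using d_matrix_degree[OF D] g' by blast
      then show ?thesis using h by (simp add: ring_map_def)
    next
      case False
      then have "x g = 0" using x unfolding cochains_def by blast
      then show ?thesis by simp
    qed
    then show "?d x g' = 0" by (simp add: differential_eq[OF D])
  qed
  show "?d (?d x) = (\<lambda>g. 0)"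
  proof
    fix g''
    let ?M = "d_matrix D arc u"
    have "?d (?d x) g'' = (\<Sum>g'\<in>all_gens D. \<Sum>g\<in>all_gens D. h (?M g' g'') * (h (?M g g') * x g))"
      by (simp add: differential_eq[OF D] sum_distrib_left)
    also have "\<dots> = (\<Sum>g\<in>all_gens D. \<Sum>g'\<in>all_gens D. h (?M g' g'') * (h (?M g g') * x g))"
      by (rule sum.swap)
    also have "\<dots> = (\<Sum>g\<in>all_gens D. h (\<Sum>g'\<in>all_gens D. ?M g g' * ?M g' g'') * x g)"
      unfolding ring_map_sum[OF h] sum_distrib_right
      using h by (intro sum.cong refl) (simp add: ring_map_def mult_ac)
    also have "\<dots> = 0"
      using h by (intro sum.neutral ballI) (simp add: d_matrix_square[OF D u] ring_map_def)
    finally show "?d (?d x) g'' = 0" .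
  qed
qed

text \<open>
  Linearity over \<open>\<int>\<^sub>\<xi>\<close>, acting through \<open>h\<close> and
  \<open>h'\<close>, is the condition that covers the ring homomorphisms as well as the
  inclusions \<open>\<int>\<^sub>o \<rightarrow> \<int>\<^sub>\<xi>\<close>,
  \<open>\<int>\<^sub>e \<rightarrow> \<int>\<^sub>\<xi>\<close> and
  \<open>\<int>\<^sub>2 \<rightarrow> \<int>\<^sub>4\<close>, which are not multiplicative.
\<close>

lemma differential_natural:
  fixes f :: "'r::comm_ring_1 \<Rightarrow> 's::comm_ring_1"
  assumes D: "planar_diagram D" and add: "\<And>a b. f (a + b) = f a + f b"
    and mult: "\<And>z a. f (h z * a) = h' z * f a"
  shows "f \<circ> differential h D arc u x = differential h' D arc u (f \<circ> x)"
proof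
  fix g'
  have sum: "f (sum k A) = (\<Sum>a\<in>A. f (k a))" for k :: "gen \<Rightarrow> 'r" and A
    by (induction A rule: infinite_finite_induct) (simp_all add: additive_zero_diff(1)[of f, OF add] add)
  show "(f \<circ> differential h D arc u x) g' = differential h' D arc u (f \<circ> x) g'"
    by (simp add: differential_eq[OF D] sum mult)
qed

section \<open>The coefficient sequences\<close>

lemma zxi_parity: "(of_int (to_o z) :: bit) = of_int (to_e z)"
proof -
  obtain a b where "z = of_int a + of_int b * (xi - 1)" using zxi_normal_form by blast
  then have "to_o z = to_e z + 2 * (- b)" by (simp add: to_e_hom to_o_hom to_e_of_int to_o_of_int)
  then show ?thesis by (simp only: of_int_add of_int_mult) simp
qed

lemma from_values:
  "to_e (from_o m) = 0" "to_o (from_o m) = 2 * m" "to_o (from_e m) = 0" "to_e (from_e m) = 2 * m"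
  by (simp_all add: from_o_def from_e_def to_e_hom to_o_hom to_e_of_int to_o_of_int)

lemma from_o_add: "from_o (a + b) = from_o a + from_o b" and from_e_add: "from_e (a + b) = from_e a + from_e b"
  by (simp_all add: from_o_def from_e_def distrib_right)

lemma from_o_mult: "from_o (to_o z * a) = z * from_o a" and from_e_mult: "from_e (to_e z * a) = z * from_e a"
  by (rule zxi_eqI; simp add: from_values to_e_hom to_o_hom)+

lemma to_e_kernel: "to_e z = 0 \<Longrightarrow> z \<in> range from_o"
proof -
  assume z: "to_e z = 0"
  obtain a b where ab: "z = of_int a + of_int b * (xi - 1)" using zxi_normal_form by blast
  have "a = 0" using z[unfolded ab] by (simp add: to_e_hom to_e_of_int)
  then have "z = from_o (- b)" using ab by (simp add: from_o_def algebra_simps)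
  then show ?thesis by blast
qed

lemma to_o_kernel: "to_o z = 0 \<Longrightarrow> z \<in> range from_e"
proof -
  assume z: "to_o z = 0"
  obtain a b where ab: "z = of_int a + of_int b * (xi - 1)" using zxi_normal_form by blast
  have "a = 2 * b" using z[unfolded ab] by (simp add: to_o_hom to_o_of_int)
  then have "z = from_e b" using ab by (simp add: from_e_def algebra_simps)
  then show ?thesis by blast
qed

lemma four_eq_0: "(4::4) = 0"
  by simp

lemma Z4_to_bit_of_int: "Z4_to_bit (of_int m) = of_int m"
proof -
  define r where "r = m mod 4"
  have "(of_int m :: 4) = of_int (4 * (m div 4) + r)" "(of_int m :: bit) = of_int (4 * (m div 4) + r)"
    by (simp_all add: r_def)
  then have "(of_int m :: 4) = of_int r" "(of_int m :: bit) = of_int r"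
    by (simp_all only: of_int_add of_int_mult of_int_numeral four_eq_0) simp_all
  moreover have "r = 0 \<or> r = 1 \<or> r = 2 \<or> r = 3" unfolding r_def by presburger
  ultimately show ?thesis by (auto simp: Z4_to_bit_def)
qed

lemma Z4_of_int: obtains m where "(x::4) = of_int m"
  by (cases x) auto

lemma Z4_to_bit_add: "Z4_to_bit (x + y) = Z4_to_bit x + Z4_to_bit y"
proof -
  obtain a b where "x = of_int a" "y = of_int b" using Z4_of_int by metis
  then show ?thesis using Z4_to_bit_of_int[of "a + b"] by (simp add: Z4_to_bit_of_int)
qed

lemma Z4_to_bit_mult: "Z4_to_bit (x * y) = Z4_to_bit x * Z4_to_bit y"
proof -
  obtain a b where "x = of_int a" "y = of_int b" using Z4_of_int by metis
  then show ?thesis using Z4_to_bit_of_int[of "a * b"] by (simp add: Z4_to_bit_of_int)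
qed

text \<open>
  The inclusion of \<open>\<int>\<^sub>2\<close> into \<open>\<int>\<^sub>4\<close> is doubling;
  this matches \<open>to_o (from_o m) = 2 * m\<close> and
  \<open>to_e (from_e m) = 2 * m\<close>.
\<close>

lemma bit_to_Z4_of_int: "bit_to_Z4 (of_int m) = of_int (2 * m)"
proof (cases "even m")
  case True
  then obtain k where k: "m = 2 * k" ..
  have "(of_int (2 * m) :: 4) = of_int (4 * k)" by (simp add: k)
  also have "\<dots> = 0" by (simp only: of_int_mult of_int_numeral four_eq_0 mult_zero_left)
  finally show ?thesis by (simp add: bit_to_Z4_def k)
next
  case False
  then obtain k where k: "m = 2 * k + 1" by (rule oddE)
  have "(of_int (2 * m) :: 4) = of_int (4 * k + 2)" by (simp add: k)
  also have "\<dots> = 2" by (simp only: of_int_add of_int_mult of_int_numeral four_eq_0 mult_zero_left) simp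
  finally show ?thesis by (simp add: bit_to_Z4_def k)
qed

lemma bit_of_int: obtains m where "(b::bit) = of_int m"
  using bit_cases[of b] of_int_0 of_int_1 by metis

lemma bit_to_Z4_add: "bit_to_Z4 (a + b) = bit_to_Z4 a + bit_to_Z4 b"
proof -
  obtain m n where "a = of_int m" "b = of_int n" using bit_of_int by metis
  then show ?thesis using bit_to_Z4_of_int[of "m + n"] by (simp only: bit_to_Z4_of_int of_int_add of_int_mult distrib_left)
qed

lemma bit_to_Z4_mult: "bit_to_Z4 (of_int k * b) = of_int k * bit_to_Z4 b"
proof -
  obtain m where "b = of_int m" using bit_of_int .
  then show ?thesis using bit_to_Z4_of_int[of "k * m"]
    by (simp only: bit_to_Z4_of_int of_int_mult mult.left_commute)
qed

lemma inj_bit_to_Z4: "inj bit_to_Z4"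
proof (rule injI)
  fix a b assume "bit_to_Z4 a = bit_to_Z4 b"
  then show "a = b" using bit_cases[of a] bit_cases[of b] by (auto simp: bit_to_Z4_def)
qed

lemma surj_Z4_to_bit: "surj Z4_to_bit"
proof (rule surjI)
  fix b show "Z4_to_bit (if b = 0 then 0 else 1) = b"
    using bit_cases[of b] by (auto simp: Z4_to_bit_def)
qed

lemma Z4_to_bit_kernel: "Z4_to_bit z = 0 \<Longrightarrow> z \<in> range bit_to_Z4"
proof -
  assume "Z4_to_bit z = 0"
  then have "z = bit_to_Z4 0 \<or> z = bit_to_Z4 1" by (auto simp: Z4_to_bit_def bit_to_Z4_def split: if_splits)
  then show ?thesis by blast
qed

lemma ring_maps:
  "ring_map id" "ring_map to_e" "ring_map to_o" "ring_map to_2"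
  by (simp_all add: ring_map_def to_e_hom to_o_hom to_2_def)

section \<open>Comparison of the Bockstein homomorphisms\<close>

text \<open>
  Both squares at once: \<open>(h, h', f)\<close> is \<open>(to_e, to_o, from_o)\<close> in the
  first and \<open>(to_o, to_e, from_e)\<close> in the second. Let the integral cochain
  \<open>x\<close> represent \<open>a\<close>, and let \<open>X\<close> be the same integers
  regarded as elements of \<open>\<int>\<^sub>\<xi>\<close>, on which \<open>h\<close> and
  \<open>h'\<close> agree. Then \<open>d\<^sub>\<xi> X = f \<circ> y\<close> for the cochain
  \<open>y\<close> that represents the integral Bockstein of \<open>a\<close>. Applying
  \<open>h'\<close> gives \<open>d' x = 2 y\<close>, so the reduction of \<open>y\<close> also
  represents the mod 2 Bockstein of the reduction of \<open>a\<close>.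
\<close>

lemma bockstein_square:
  fixes h h' :: "zxi \<Rightarrow> int" and f :: "int \<Rightarrow> zxi"
  assumes D: "planar_diagram D" and u: "unit_choice D arc u"
    and h: "ring_map h" "\<And>m. h (of_int m) = m" "\<And>z. (of_int (h z) :: bit) = to_2 z"
    and h': "ring_map h'" "\<And>m. h' (of_int m) = m" "\<And>z. (of_int (h' z) :: bit) = to_2 z"
    and f: "\<And>a b. f (a + b) = f a + f b" "\<And>z a. f (h' z * a) = z * f a" "\<And>m. h' (f m) = 2 * m"
    and exact: "\<And>z. h z = 0 \<Longrightarrow> z \<in> range f"
    and a: "a \<in> carrier (cohomology D (differential h D arc u) i)"
  shows "red_2 D arc u (i + 1) (connecting D f h (differential h' D arc u) (d_xi D arc u) i a) =
    connecting D bit_to_Z4 Z4_to_bit (d_2 D arc u) (differential (\<lambda>z. of_int (h' z) :: 4) D arc u) i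
      (red_2 D arc u i a)"
proof -
  let ?d = "differential h D arc u" and ?d' = "differential h' D arc u"
  let ?d4 = "differential (\<lambda>z. of_int (h' z) :: 4) D arc u"
  have h4: "ring_map (\<lambda>z. of_int (h' z) :: 4)" using h'(1) by (simp add: ring_map_def)
  note diff = is_differential_differential[OF D u]
  note natural = differential_natural[OF D, of _ _ _ arc u]
  have f0: "f 0 = 0" by (rule additive_zero_diff(1)[of f, OF f(1)])
  have h_add: "h (z + z') = h z + h z'" for z z' using h(1) by (simp add: ring_map_def)
  have h_surj: "surj h" by (rule surjI[of h of_int]) (rule h(2))
  have f_inj: "inj f" by (rule injI) (use f(3) in \<open>metis mult_cancel_left zero_neq_numeral\<close>)
  have f_comm: "f \<circ> ?d' y = d_xi D arc u (f \<circ> y)" for y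
    using f by (intro natural) simp_all
  have h_comm: "h \<circ> d_xi D arc u y = ?d (h \<circ> y)" for y
    using h(1) by (intro natural) (simp_all add: ring_map_def)
  have h'_comm: "h' \<circ> d_xi D arc u y = ?d' (h' \<circ> y)" for y
    using h'(1) by (intro natural) (simp_all add: ring_map_def)
  have red: "of_int \<circ> ?d y = d_2 D arc u (of_int \<circ> y)" for y
    using h(3) by (intro natural) simp_all
  have red': "of_int \<circ> ?d' y = d_2 D arc u (of_int \<circ> y)" for y
    using h'(3) by (intro natural) simp_all
  have red4: "of_int \<circ> ?d' y = ?d4 (of_int \<circ> y)" for y
    by (intro natural) simp_all
  have Z4_comm: "bit_to_Z4 \<circ> d_2 D arc u y = ?d4 (bit_to_Z4 \<circ> y)" for y
    by (intro natural bit_to_Z4_add) (subst h'(3)[symmetric], rule bit_to_Z4_mult)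
  have bit_comm: "Z4_to_bit \<circ> ?d4 y = d_2 D arc u (Z4_to_bit \<circ> y)" for y
    by (intro natural Z4_to_bit_add) (simp add: Z4_to_bit_mult Z4_to_bit_of_int h'(3))

  obtain x where x: "x \<in> cochains D i" "?d x = (\<lambda>g. 0)" and ax: "a = cohomology_class D ?d i x"
    using a by (auto simp: carrier_cohomology)
  define X where "X = (of_int :: int \<Rightarrow> zxi) \<circ> x"
  have X: "X \<in> cochains D i" unfolding X_def using x(1) by (intro cochains_comp) simp_all
  have hX: "h \<circ> X = x" and h'X: "h' \<circ> X = x" by (simp_all add: X_def fun_eq_iff h(2) h'(2))
  define y where "y = (\<lambda>g. h' (d_xi D arc u X g) div 2)"
  have fy: "d_xi D arc u X = f \<circ> y"
  proof
    fix g
    have "h (d_xi D arc u X g) = 0" using fun_cong[OF h_comm[of X], of g] x(2) hX by simp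
    then obtain m where "d_xi D arc u X g = f m" using exact by blast
    then show "d_xi D arc u X g = (f \<circ> y) g" by (simp add: y_def f(3))
  qed
  have "h' 0 = 0" using h'(1) by (simp add: ring_map_def)
  then have y: "y \<in> cochains D (i + 1)"
    using differential_cochains[OF diff[OF ring_maps(1)] X] by (simp add: y_def cochains_def)
  have "f \<circ> ?d' y = (\<lambda>g. 0)"
    using f_comm[of y] fy differential_square[OF diff[OF ring_maps(1)] X] by simp
  then have "f (?d' y g) = f 0" for g using f0 by (metis comp_apply)
  then have dy: "?d' y = (\<lambda>g. 0)" using f_inj by (auto simp: inj_def)
  have dx: "?d' x = (\<lambda>g. 2 * y g)" using h'_comm[of X] h'X fy by (auto simp: fun_eq_iff f(3))

  have "connecting D f h ?d' (d_xi D arc u) i (cohomology_class D ?d i (h \<circ> X)) =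
      cohomology_class D ?d' (i + 1) y"
    by (rule connecting_cohomology_class[OF diff[OF h'(1)] diff[OF ring_maps(1)] diff[OF h(1)]
          f(1) h_add f_inj h_surj exact f_comm h_comm X y fy])
  then have "red_2 D arc u (i + 1) (connecting D f h ?d' (d_xi D arc u) i a) =
      cohomology_class D (d_2 D arc u) (i + 1) (of_int \<circ> y)"
    unfolding ax hX red_2_def
    by (simp only:) (rule induced_cohomology_class[OF diff[OF h'(1)] diff[OF ring_maps(4)] _ red' y dy], simp)
  moreover have "red_2 D arc u i a = cohomology_class D (d_2 D arc u) i (of_int \<circ> x)"
    unfolding ax red_2_def
    by (rule induced_cohomology_class[OF diff[OF h(1)] diff[OF ring_maps(4)] _ red x]) simp
  moreover have "connecting D bit_to_Z4 Z4_to_bit (d_2 D arc u) ?d4 i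
      (cohomology_class D (d_2 D arc u) i (Z4_to_bit \<circ> (of_int \<circ> x))) =
      cohomology_class D (d_2 D arc u) (i + 1) (of_int \<circ> y)"
  proof (rule connecting_cohomology_class[OF diff[OF ring_maps(4)] diff[OF h4] diff[OF ring_maps(4)]
        bit_to_Z4_add Z4_to_bit_add inj_bit_to_Z4 surj_Z4_to_bit Z4_to_bit_kernel Z4_comm bit_comm])
    show "of_int \<circ> x \<in> cochains D i" using x(1) by (intro cochains_comp) simp_all
    show "of_int \<circ> y \<in> cochains D (i + 1)" using y by (intro cochains_comp) simp_all
    show "?d4 (of_int \<circ> x) = bit_to_Z4 \<circ> (of_int \<circ> y)"
      using red4[of x] dx by (auto simp: fun_eq_iff bit_to_Z4_of_int)
  qed
  moreover have "Z4_to_bit \<circ> (of_int \<circ> x) = of_int \<circ> x" by (simp add: fun_eq_iff Z4_to_bit_of_int)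
  ultimately show ?thesis by simp
qed

theorem proposition4p1:
  fixes D :: diagram and arc :: "nat \<Rightarrow> bool" and u :: "nat set \<times> nat \<Rightarrow> zxi" and i :: int
  assumes "planar_diagram D" and "unit_choice D arc u"
  shows "(\<forall>a\<in>carrier (H_e D arc u i).
            red_2 D arc u (i + 1) (phi_eo D arc u i a) = beta_o D arc u i (red_2 D arc u i a)) \<and>
         (\<forall>a\<in>carrier (H_o D arc u i).
            red_2 D arc u (i + 1) (phi_oe D arc u i a) = beta_e D arc u i (red_2 D arc u i a))"
proof (intro conjI ballI)
  fix a assume "a \<in> carrier (H_e D arc u i)"
  then show "red_2 D arc u (i + 1) (phi_eo D arc u i a) = beta_o D arc u i (red_2 D arc u i a)"
    unfolding phi_eo_def beta_o_def H_e_def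
    by (intro bockstein_square[OF assms, of to_e to_o from_o])
      (simp_all add: ring_maps to_e_of_int to_o_of_int to_2_def zxi_parity from_values to_e_kernel
        from_o_add from_o_mult)
next
  fix a assume "a \<in> carrier (H_o D arc u i)"
  then show "red_2 D arc u (i + 1) (phi_oe D arc u i a) = beta_e D arc u i (red_2 D arc u i a)"
    unfolding phi_oe_def beta_e_def H_o_def
    by (intro bockstein_square[OF assms, of to_o to_e from_e])
      (simp_all add: ring_maps to_e_of_int to_o_of_int to_2_def zxi_parity from_values to_o_kernel
        from_e_add from_e_mult)
qed

end
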